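(* Let $G$ be a finite group, $H<G$ a subgroup, and $\Omega=[G:H]$ the set of left cosets of $H$ in $G$, on which $G$ acts by left multiplication. Let $C=\{\chi\in\mathrm{Irr}(G) : \chi(\mathbf{v}_H)=0\}$ and let $\mathfrak{S}$ be the collection of maximum intersecting sets in $G$ (with respect to the action on $\Omega$). Then the action of $G$ on $\Omega$ satisfies the EKR-module property if and only if $\chi(\mathbf{v}_{\mathcal{S}})=0$ for every $\mathcal{S}\in\mathfrak{S}$ and every $\chi\in C$.
   Context: Let $G$ be a finite group acting transitively on a set $\Omega$. Elements $\sigma,\tau\in G$ intersect if $\sigma\tau^{-1}$ fixes a point of $\Omega$; a subset of $G$ is an intersecting set if any two of its elements intersect; a maximum intersecting set is an intersecting set of maximum possible size. For $S\subseteq G$, $\mathbf{v}_S=\sum_{s\in S}s\in\mathbb{C}G$ is its characteristic vector in the group algebra. The canonical vectors are $\mathbf{v}_{\alpha,\beta}=\sum_{t\in G,\ t\cdot\alpha=\beta}t$ for $\alpha,\beta\in\Omega$ (the characteristic vectors of the cosets $gG_\alpha$). The action of $G$ on $\Omega$ satisfies the EKR-module property if the characteristic vector of each maximum intersecting set is a $\mathbb{C}$-linear combination of canonical vectors. $\mathrm{Irr}(G)$ is the set of irreducible complex characters of $G$, and for a character $\chi$ and $A\subseteq G$, $\chi(\mathbf{v}_A)=\sum_{a\in A}\chi(a)$. *)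

theory Defs
  imports
    Complex_Main
    "HOL-Algebra.Group_Action"
    "HOL-Algebra.Left_Coset"
    "HOL-Library.Indicator_Function"
    "Jordan_Normal_Form.VS_Connect"
begin

section \<open>Irreducible complex characters\<close>

definition GL :: "nat \<Rightarrow> complex mat monoid" where
  "GL n = units_of (ring_mat TYPE(complex) n ())"

definition representation ::
    "('a, 'b) monoid_scheme \<Rightarrow> nat \<Rightarrow> ('a \<Rightarrow> complex mat) \<Rightarrow> bool" where
  "representation G n \<rho> \<longleftrightarrow> \<rho> \<in> hom G (GL n)"

definition irreducible_representation ::
    "('a, 'b) monoid_scheme \<Rightarrow> nat \<Rightarrow> ('a \<Rightarrow> complex mat) \<Rightarrow> bool" where
  "irreducible_representation G n \<rho> \<longleftrightarrow>
     representation G n \<rho> \<and> n > 0 \<and>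
     (\<forall>W. VectorSpace.subspace class_ring W (module_vec TYPE(complex) n) \<longrightarrow>
          (\<forall>g\<in>carrier G. \<forall>w\<in>W. \<rho> g *\<^sub>v w \<in> W) \<longrightarrow>
          W = {0\<^sub>v n} \<or> W = carrier_vec n)"

definition trace :: "complex mat \<Rightarrow> complex" where
  "trace A = (\<Sum>i<dim_row A. A $$ (i, i))"

text \<open>Characters are made extensional, so that \<open>Irr G\<close> has exactly one element for each
  irreducible character, regarded as a function on \<open>carrier G\<close>.\<close>

definition character ::
    "('a, 'b) monoid_scheme \<Rightarrow> ('a \<Rightarrow> complex mat) \<Rightarrow> 'a \<Rightarrow> complex" where
  "character G \<rho> = (\<lambda>g\<in>carrier G. trace (\<rho> g))"

definition Irr :: "('a, 'b) monoid_scheme \<Rightarrow> ('a \<Rightarrow> complex) set" where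
  "Irr G = {character G \<rho> | n \<rho>. irreducible_representation G n \<rho>}"

definition char_sum :: "('a \<Rightarrow> complex) \<Rightarrow> 'a set \<Rightarrow> complex" where
  "char_sum \<chi> A = (\<Sum>a\<in>A. \<chi> a)"


section \<open>Intersecting sets and the EKR-module property\<close>

definition intersect ::
    "('a, 'b) monoid_scheme \<Rightarrow> 'c set \<Rightarrow> ('a \<Rightarrow> 'c \<Rightarrow> 'c) \<Rightarrow> 'a \<Rightarrow> 'a \<Rightarrow> bool" where
  "intersect G \<Omega> \<phi> \<sigma> \<tau> \<longleftrightarrow> (\<exists>\<omega>\<in>\<Omega>. \<phi> (\<sigma> \<otimes>\<^bsub>G\<^esub> inv\<^bsub>G\<^esub> \<tau>) \<omega> = \<omega>)"

definition intersecting_set ::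
    "('a, 'b) monoid_scheme \<Rightarrow> 'c set \<Rightarrow> ('a \<Rightarrow> 'c \<Rightarrow> 'c) \<Rightarrow> 'a set \<Rightarrow> bool" where
  "intersecting_set G \<Omega> \<phi> S \<longleftrightarrow>
     S \<subseteq> carrier G \<and> (\<forall>\<sigma>\<in>S. \<forall>\<tau>\<in>S. intersect G \<Omega> \<phi> \<sigma> \<tau>)"

definition maximum_intersecting_sets ::
    "('a, 'b) monoid_scheme \<Rightarrow> 'c set \<Rightarrow> ('a \<Rightarrow> 'c \<Rightarrow> 'c) \<Rightarrow> 'a set set" where
  "maximum_intersecting_sets G \<Omega> \<phi> =
     {S. intersecting_set G \<Omega> \<phi> S \<and> (\<forall>T. intersecting_set G \<Omega> \<phi> T \<longrightarrow> card T \<le> card S)}"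

text \<open>Elements of the group algebra are represented by their coefficient functions, which
  vanish outside \<open>carrier G\<close>.\<close>

definition char_vec :: "'a set \<Rightarrow> 'a \<Rightarrow> complex" where
  "char_vec S = indicator S"

definition canonical_vec ::
    "('a, 'b) monoid_scheme \<Rightarrow> ('a \<Rightarrow> 'c \<Rightarrow> 'c) \<Rightarrow> 'c \<Rightarrow> 'c \<Rightarrow> 'a \<Rightarrow> complex" where
  "canonical_vec G \<phi> \<alpha> \<beta> = char_vec {t \<in> carrier G. \<phi> t \<alpha> = \<beta>}"

definition EKR_module_property ::
    "('a, 'b) monoid_scheme \<Rightarrow> 'c set \<Rightarrow> ('a \<Rightarrow> 'c \<Rightarrow> 'c) \<Rightarrow> bool" where
  "EKR_module_property G \<Omega> \<phi> \<longleftrightarrow>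
     (\<forall>S\<in>maximum_intersecting_sets G \<Omega> \<phi>.
        \<exists>c :: 'c \<Rightarrow> 'c \<Rightarrow> complex.
          char_vec S = (\<lambda>g. \<Sum>\<alpha>\<in>\<Omega>. \<Sum>\<beta>\<in>\<Omega>. c \<alpha> \<beta> * canonical_vec G \<phi> \<alpha> \<beta> g))"


section \<open>The action on left cosets\<close>

definition left_coset_action ::
    "('a, 'b) monoid_scheme \<Rightarrow> 'a set \<Rightarrow> 'a \<Rightarrow> 'a set \<Rightarrow> 'a set" where
  "left_coset_action G H g = (\<lambda>X\<in>lcosets\<^bsub>G\<^esub> H. g <#\<^bsub>G\<^esub> X)"

lemma left_coset_action_transitive:
  fixes G (structure)
  assumes "group G" and "subgroup H G"
  shows "transitive_action G (lcosets H) (left_coset_action G H)"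
proof -
  interpret group G by fact
  interpret H: subgroup H G by fact
  let ?E = "lcosets H" and ?a = "left_coset_action G H"
  have sub: "X \<subseteq> carrier G" if "X \<in> ?E" for X
    using H.lcosets_carrier[OF assms(1) that] .
  have closed: "g <# X \<in> ?E" if "g \<in> carrier G" "X \<in> ?E" for g X
    using that H.subset by (auto simp: LCOSETS_def lcos_m_assoc)
  have comp: "g <# (h <# X) = (g \<otimes> h) <# X" if "g \<in> carrier G" "h \<in> carrier G" "X \<in> ?E" for g h X
    using that sub by (simp add: lcos_m_assoc)
  have one: "\<one> <# X = X" if "X \<in> ?E" for X
    using that sub by (simp add: lcos_mult_one)
  have bij: "?a g \<in> Bij ?E" if g: "g \<in> carrier G" for g
  proof -
    have "bij_betw (?a g) ?E ?E"
      by (rule bij_betw_byWitness[where f' = "?a (inv g)"])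
         (use g closed comp one in \<open>auto simp: left_coset_action_def\<close>)
    then show ?thesis by (simp add: Bij_def left_coset_action_def)
  qed
  have "?a \<in> hom G (BijGroup ?E)"
  proof (rule homI)
    show "?a g \<in> carrier (BijGroup ?E)" if "g \<in> carrier G" for g
      using bij[OF that] by (simp add: BijGroup_def)
    show "?a (g \<otimes> h) = ?a g \<otimes>\<^bsub>BijGroup ?E\<^esub> ?a h" if "g \<in> carrier G" "h \<in> carrier G" for g h
      using that bij closed comp
      by (auto simp: BijGroup_def compose_def left_coset_action_def fun_eq_iff)
  qed
  then have act: "group_action G ?E ?a"
    by (simp add: group_action_def group_hom_def group_hom_axioms_def group_BijGroup assms(1))
  have "\<exists>g\<in>carrier G. ?a g X = Y" if X: "X \<in> ?E" and Y: "Y \<in> ?E" for X Y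
  proof -
    obtain x y where x: "x \<in> carrier G" "X = x <# H" and y: "y \<in> carrier G" "Y = y <# H"
      using X Y by (auto simp: LCOSETS_def)
    have "?a (y \<otimes> inv x) X = (y \<otimes> inv x) <# (x <# H)"
      using X x by (simp add: left_coset_action_def)
    also have "\<dots> = Y"
      using x y H.subset by (simp add: lcos_m_assoc m_assoc)
    finally show ?thesis using x y by (intro bexI[of _ "y \<otimes> inv x"]) auto
  qed
  with act show ?thesis
    by (simp add: transitive_action_def transitive_action_axioms_def)
qed

end

theory Submission
  imports Defs
begin

text \<open>
  Let \<open>I\<close> be the span of the canonical vectors in the group algebra. Translating a canonical vector
  on either side gives a canonical vector, so \<open>I\<close> is a two-sided ideal, namely the one generated
  by \<open>v\<^sub>H\<close>, and the EKR-module property says that \<open>v\<^sub>S\<close> lies in \<open>I\<close> for every maximum intersecting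
  set \<open>S\<close>.

  If \<open>v\<^sub>S\<close> lies in \<open>I\<close>, then \<open>\<chi>(v\<^sub>S) = 0\<close> for all \<open>\<chi> \<in> C\<close>: for a representation \<open>\<rho>\<close> the matrix
  \<open>\<rho>(v\<^sub>H)\<close> is \<open>|H|\<close> times an idempotent, so it vanishes as soon as its trace \<open>\<chi>(v\<^sub>H)\<close> does
  (\<open>subgroup_sum_eq_0_if_character_sum_eq_0\<close>), and then \<open>\<chi>\<close> vanishes on every canonical vector
  \<open>b v\<^sub>H a\<^sup>-\<^sup>1\<close>.

  For the converse, right translates of maximum intersecting sets are again maximum intersecting
  sets, so the hypothesis gives \<open>\<chi>(v\<^sub>S g) = 0\<close> for all \<open>g\<close>. Split the identity of the group algebra
  as \<open>1 = e + s\<close> with \<open>s \<in> I\<close> and \<open>e\<close> orthogonal to \<open>I\<close>. Because \<open>I\<close> and its orthogonal complement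
  are both two-sided ideals, \<open>e\<close> is a central idempotent with \<open>e I = 0\<close>
  (\<open>exists_canonical_idempotent\<close>). Let \<open>g\<close> act on the group algebra by left multiplication with
  \<open>g e\<close>. The trace of this action is \<open>|G| e(g\<^sup>-\<^sup>1)\<close>, and \<open>v\<^sub>H\<close> acts as \<open>v\<^sub>H e = 0\<close>. A composition
  series therefore writes the function \<open>g \<mapsto> |G| e(g\<^sup>-\<^sup>1)\<close> as a sum of members of \<open>C\<close>
  (\<open>composition_factor_characters\<close>). Summing \<open>\<chi>(v\<^sub>S g) = 0\<close> over these characters yields
  \<open>v\<^sub>S e = 0\<close>, that is, \<open>v\<^sub>S = v\<^sub>S s \<in> I\<close> (\<open>canonical_span_if_characters_vanish\<close>).
\<close>

section \<open>Subspaces, coordinates and traces\<close>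

text \<open>A basis of \<open>W\<close> extended to a basis of the whole space: the columns of \<open>P\<close> are the basis vectors,
  those of \<open>W\<close> first, and \<open>Q\<close> computes coordinates.\<close>
lemma subspace_coordinates:
  assumes W: "VectorSpace.subspace class_ring W (module_vec TYPE('k::field) n)"
  obtains k P Q where "k \<le> n" "P \<in> carrier_mat n n" "Q \<in> carrier_mat n n"
    "P * Q = 1\<^sub>m n" "Q * P = 1\<^sub>m n"
    "\<And>v. v \<in> carrier_vec n \<Longrightarrow> v \<in> W \<longleftrightarrow> (\<forall>i<n. k \<le> i \<longrightarrow> (Q *\<^sub>v v) $ i = 0)"
proof -
  interpret V: vec_space "TYPE('k)" n .
  have sub: "submodule class_ring W (module_vec TYPE('k) n)"
    using W by (simp add: VectorSpace.subspace_def)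
  have WC: "W \<subseteq> carrier_vec n"
    using submodule.subset[OF sub] by (simp add: module_vec_simps)
  let ?li = "\<lambda>A. A \<subseteq> W \<and> V.lin_indpt A"
  \<comment> \<open>A maximal independent subset of \<open>W\<close> spans \<open>W\<close>.\<close>
  have "\<exists>A. finite A \<and> maximal A ?li"
  proof (rule maximal_exists[where N = n and B = "{}"])
    fix A assume "?li A"
    then show "finite A \<and> card A \<le> n"
      using V.li_le_dim[of A] WC V.dim_is_n by auto
  next
    show "?li {}" by (auto simp: V.lin_dep_def)
  qed
  then obtain A where A: "finite A" "A \<subseteq> W" "V.lin_indpt A" and max: "maximal A ?li"
    by (auto simp: maximal_def)
  have AC: "A \<subseteq> carrier_vec n" using A WC by blast
  have spanA: "V.span A = W"
  proof
    show "V.span A \<subseteq> W" using V.span_is_subset[OF A(2) sub] .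
    show "W \<subseteq> V.span A"
    proof (rule subsetI, rule ccontr)
      fix v assume v: "v \<in> W" "v \<notin> V.span A"
      have vA: "v \<notin> A" using v(2) V.in_own_span[of A] AC by auto
      have "V.lin_indpt (A \<union> {v})"
        using V.lin_dep_iff_in_span[of A v] AC A v vA WC by auto
      then have "A \<union> {v} = A" using max A v unfolding maximal_def by blast
      with vA show False by blast
    qed
  qed
  let ?U = "set (unit_vecs n) :: 'k vec set"
  have Uc: "card ?U = n" using distinct_card[OF V.unit_vecs_distinct] V.unit_vecs_length by simp
  have UC: "?U \<subseteq> carrier_vec n" by (auto simp: unit_vecs_def)
  \<comment> \<open>Steinitz exchange against the unit vectors supplies the remaining basis vectors.\<close>
  have "\<exists>C. finite C \<and> C \<subseteq> carrier_vec n \<and> C \<subseteq> V.span ?U \<and> C \<inter> A = {} \<and>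
      int (card C) \<le> int (card ?U) - int (card A) \<and> V.span (A \<union> C) = V.span ?U"
    by (rule V.replacement) (use A AC UC V.span_unit_vecs_is_carrier in auto)
  then obtain C where C: "finite C" "C \<subseteq> carrier_vec n" "C \<inter> A = {}"
      and cardC: "int (card C) \<le> int (card ?U) - int (card A)" and "V.span (A \<union> C) = V.span ?U"
    by metis
  then have spanC: "V.span (A \<union> C) = carrier_vec n" by (simp only: V.span_unit_vecs_is_carrier)
  have cardC: "card A + card C \<le> n" using cardC Uc by linarith
  have "card (A \<union> C) \<ge> n"
    using V.gen_ge_dim[of "A \<union> C"] A(1) C(1,2) AC spanC V.dim_is_n by simp
  then have card: "card A + card C = n"
    using cardC card_Un_le[of A C] by linarith
  obtain as cs where as: "set as = A" "distinct as" and cs: "set cs = C" "distinct cs"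
    using A(1) C(1) finite_distinct_list by metis
  define k where "k = length as"
  have len: "length (as @ cs) = n" "k = card A" "k \<le> n"
    using as cs card by (auto simp: k_def simp flip: distinct_card)
  define P where "P = mat_of_cols n (as @ cs)"
  have P: "P \<in> carrier_mat n n" unfolding P_def using len mat_of_cols_carrier(1)[of n "as @ cs"] by simp
  have dist: "distinct (as @ cs)" using as cs C by auto
  have setC: "set (as @ cs) = A \<union> C" using as cs by simp
  have comb: "V.lincomb f (A \<union> C) = P *\<^sub>v vec n (\<lambda>i. f ((as @ cs) ! i))" for f
  proof -
    have "V.lincomb f (A \<union> C) = V.lincomb_list (\<lambda>i. f ((as @ cs) ! i)) (as @ cs)"
      using V.lincomb_as_lincomb_list_distinct[of "as @ cs" f] dist setC AC C
      by (metis Un_least)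
    also have "\<dots> = P *\<^sub>v vec n (\<lambda>i. f ((as @ cs) ! i))"
      unfolding P_def using len AC C setC
      by (subst V.lincomb_list_as_mat_mult) auto
    finally show ?thesis .
  qed
  have surj: "\<exists>x\<in>carrier_vec n. P *\<^sub>v x = v" if "v \<in> carrier_vec n" for v
  proof -
    have "v \<in> V.span (A \<union> C)" using that spanC by simp
    then obtain f where "v = V.lincomb f (A \<union> C)"
      using V.finite_span[of "A \<union> C"] A C AC by auto
    then show ?thesis using comb[of f] by auto
  qed
  \<comment> \<open>The basis spans, so every unit vector has a preimage under \<open>P\<close>; these are the columns of \<open>Q\<close>.\<close>
  have "\<forall>j. \<exists>x. j < n \<longrightarrow> x \<in> carrier_vec n \<and> P *\<^sub>v x = unit_vec n j"
    using surj by (metis unit_vec_carrier)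
  then obtain q where q: "\<And>j. j < n \<Longrightarrow> q j \<in> carrier_vec n \<and> P *\<^sub>v q j = unit_vec n j"
    by metis
  define Q where "Q = mat_of_cols n (map q [0..<n])"
  have Q: "Q \<in> carrier_mat n n" unfolding Q_def using mat_of_cols_carrier(1)[of n "map q [0..<n]"] by simp
  have colQ: "col Q j = q j" if "j < n" for j
    unfolding Q_def using that q by (subst col_mat_of_cols) auto
  have PQ: "P * Q = 1\<^sub>m n"
  proof (rule mat_col_eqI)
    fix j assume "j < dim_col (1\<^sub>m n :: 'k mat)"
    then have j: "j < n" by simp
    have "col (P * Q) j = P *\<^sub>v col Q j" using P Q j by (subst col_mult2) auto
    then show "col (P * Q) j = col (1\<^sub>m n) j" using colQ q j by simp
  qed (use P Q in auto)
  have QP: "Q * P = 1\<^sub>m n" using mat_mult_left_right_inverse[OF P Q PQ] .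
  have iff: "v \<in> W \<longleftrightarrow> (\<forall>i<n. k \<le> i \<longrightarrow> (Q *\<^sub>v v) $ i = 0)" if v: "v \<in> carrier_vec n" for v
  proof
    assume "v \<in> W"
    then obtain f where f: "v = V.lincomb f A"
      using spanA V.finite_span[of A] A AC by auto
    let ?f = "\<lambda>x. if x \<in> A then f x else 0"
    have "V.lincomb ?f (A \<union> C) = V.lincomb ?f A + V.lincomb ?f C"
      using V.lincomb_union[of A C ?f] A C AC by (auto simp: Int_commute)
    also have "V.lincomb ?f C = 0\<^sub>v n"
      using C by (intro V.lincomb_zero) auto
    also have "V.lincomb ?f A = V.lincomb f A"
      by (rule V.lincomb_cong) (use AC in auto)
    finally have "v = V.lincomb ?f (A \<union> C)"
      using f v by simp
    then have "v = P *\<^sub>v vec n (\<lambda>i. ?f ((as @ cs) ! i))" using comb by simp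
    then have "Q *\<^sub>v v = (Q * P) *\<^sub>v vec n (\<lambda>i. ?f ((as @ cs) ! i))"
      using P Q by (simp add: assoc_mult_mat_vec[of Q n n P n])
    then have Qv: "Q *\<^sub>v v = vec n (\<lambda>i. ?f ((as @ cs) ! i))" using QP by simp
    show "\<forall>i<n. k \<le> i \<longrightarrow> (Q *\<^sub>v v) $ i = 0"
    proof (intro allI impI)
      fix i assume i: "i < n" "k \<le> i"
      then have "(as @ cs) ! i \<in> C" using len cs by (auto simp: nth_append k_def)
      then show "(Q *\<^sub>v v) $ i = 0" using C i Qv by auto
    qed
  next
    assume 0: "\<forall>i<n. k \<le> i \<longrightarrow> (Q *\<^sub>v v) $ i = 0"
    have "v = (P * Q) *\<^sub>v v" using PQ v by simp
    also have "\<dots> = P *\<^sub>v (Q *\<^sub>v v)" using P Q v by (simp add: assoc_mult_mat_vec[of P n n Q n])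
    finally have vP: "v = P *\<^sub>v (Q *\<^sub>v v)" .
    define f where "f x = (Q *\<^sub>v v) $ (THE i. i < n \<and> (as @ cs) ! i = x)" for x
    have f: "f ((as @ cs) ! i) = (Q *\<^sub>v v) $ i" if "i < n" for i
    proof -
      have "(THE j. j < n \<and> (as @ cs) ! j = (as @ cs) ! i) = i"
        using that dist len by (intro the_equality) (auto simp: nth_eq_iff_index_eq)
      then show ?thesis by (simp add: f_def)
    qed
    have "vec n (\<lambda>i. f ((as @ cs) ! i)) = Q *\<^sub>v v" using f Q by (intro eq_vecI) auto
    then have "v = V.lincomb f (A \<union> C)" using vP comb by simp
    also have "\<dots> = V.lincomb f A + V.lincomb f C"
      using V.lincomb_union[of A C f] A C AC by (auto simp: Int_commute)
    also have "V.lincomb f C = 0\<^sub>v n"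
    proof (rule V.lincomb_zero)
      show "f \<in> C \<rightarrow> {0}"
      proof
        fix x assume "x \<in> C"
        then obtain m where m: "m < length cs" "x = cs ! m" using cs by (metis in_set_conv_nth)
        have "x = (as @ cs) ! (k + m)" using m by (simp only: k_def nth_append_length_plus)
        moreover have "k + m < n" using m len(1) by (simp add: k_def)
        ultimately show "f x \<in> {0}" using f[of "k + m"] 0 by simp
      qed
    qed (use C in auto)
    also have "V.lincomb f A + 0\<^sub>v n = V.lincomb f A"
      using AC by (simp add: V.lincomb_closed)
    finally have "v \<in> V.span A" using A AC by (auto simp: V.finite_span)
    then show "v \<in> W" using spanA by simp
  qed
  show ?thesis using that[OF len(3) P Q PQ QP iff] .
qed

lemma index_mult_mat_sum:
  assumes "A \<in> carrier_mat n m" "B \<in> carrier_mat m p" "i < n" "j < p"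
  shows "(A * B) $$ (i, j) = (\<Sum>l<m. A $$ (i, l) * B $$ (l, j))"
  using assms by (auto simp: scalar_prod_def lessThan_atLeast0)

lemma trace_mult_commute:
  assumes "A \<in> carrier_mat n m" "B \<in> carrier_mat m n"
  shows "trace (A * B) = trace (B * A)"
proof -
  have "trace (A * B) = (\<Sum>i<n. \<Sum>l<m. A $$ (i, l) * B $$ (l, i))"
    using assms by (simp add: trace_def index_mult_mat_sum[OF assms] del: index_mult_mat(1))
  also have "\<dots> = (\<Sum>l<m. \<Sum>i<n. B $$ (l, i) * A $$ (i, l))"
    by (subst sum.swap) (simp add: mult.commute)
  also have "\<dots> = trace (B * A)"
    using assms by (simp add: trace_def index_mult_mat_sum[OF assms(2,1)] del: index_mult_mat(1))
  finally show ?thesis .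
qed

lemma trace_conjugate:
  assumes "P \<in> carrier_mat n n" "Q \<in> carrier_mat n n" "A \<in> carrier_mat n n" "P * Q = 1\<^sub>m n"
  shows "trace (Q * A * P) = trace A"
proof -
  have "trace (Q * A * P) = trace (P * (Q * A))"
    using assms by (intro trace_mult_commute) auto
  also have "P * (Q * A) = (P * Q) * A"
    using assms(1-3) by (simp add: assoc_mult_mat[of P n n Q n A n])
  finally show ?thesis using assms by simp
qed

lemma index_mult_mat3:
  assumes "A \<in> carrier_mat n n" "B \<in> carrier_mat n n" "C \<in> carrier_mat n n" "i < n" "j < n"
  shows "(A * B * C) $$ (i, j) = (\<Sum>p<n. \<Sum>q<n. A $$ (i, p) * B $$ (p, q) * C $$ (q, j))"
proof -
  have "(A * B * C) $$ (i, j) = (\<Sum>q<n. (\<Sum>p<n. A $$ (i, p) * B $$ (p, q)) * C $$ (q, j))"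
    using index_mult_mat_sum[of "A * B" n n C n i j] index_mult_mat_sum[of A n n B n i] assms
    by (simp del: index_mult_mat(1))
  then show ?thesis by (subst sum.swap) (simp add: sum_distrib_right)
qed

lemma subspace_image:
  assumes E: "E \<in> carrier_mat n n"
  shows "VectorSpace.subspace class_ring {E *\<^sub>v v | v. v \<in> carrier_vec n} (module_vec TYPE('k::field) n)"
proof -
  interpret V: vec_space "TYPE('k)" n .
  have "submodule class_ring {E *\<^sub>v v | v. v \<in> carrier_vec n} (module_vec TYPE('k) n)"
  proof
    show "{E *\<^sub>v v | v. v \<in> carrier_vec n} \<subseteq> carrier (module_vec TYPE('k) n)"
      using E by (auto simp: module_vec_simps)
  next
    fix v w assume "v \<in> {E *\<^sub>v v | v. v \<in> carrier_vec n}" "w \<in> {E *\<^sub>v v | v. v \<in> carrier_vec n}"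
    then obtain x y where "x \<in> carrier_vec n" "y \<in> carrier_vec n" "v = E *\<^sub>v x" "w = E *\<^sub>v y" by auto
    then show "v \<oplus>\<^bsub>module_vec TYPE('k) n\<^esub> w \<in> {E *\<^sub>v v | v. v \<in> carrier_vec n}"
      using E by (auto simp: module_vec_simps mult_add_distrib_mat_vec[symmetric] intro!: exI[of _ "x + y"])
  next
    show "\<zero>\<^bsub>module_vec TYPE('k) n\<^esub> \<in> {E *\<^sub>v v | v. v \<in> carrier_vec n}"
      using E by (auto simp: module_vec_simps intro!: exI[of _ "0\<^sub>v n"])
  next
    fix c v assume "v \<in> {E *\<^sub>v v | v. v \<in> carrier_vec n}"
    then obtain x where "x \<in> carrier_vec n" "v = E *\<^sub>v x" by auto
    then show "c \<odot>\<^bsub>module_vec TYPE('k) n\<^esub> v \<in> {E *\<^sub>v v | v. v \<in> carrier_vec n}"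
      using E by (auto simp: module_vec_simps mult_mat_vec intro!: exI[of _ "c \<cdot>\<^sub>v x"])
  qed
  then show ?thesis
    by (simp add: VectorSpace.subspace_def vec_vs)
qed

lemma mult_mat_vec_cancel:
  assumes "(P :: 'k::field mat) \<in> carrier_mat n n" "Q \<in> carrier_mat n n" "P * Q = 1\<^sub>m n" "v \<in> carrier_vec n"
  shows "P *\<^sub>v (Q *\<^sub>v v) = v"
  unfolding assoc_mult_mat_vec[OF assms(1,2,4), symmetric] assms(3)
  by (rule one_mult_mat_vec[OF assms(4)])

lemma mult_unit_vec_eq_col:
  assumes "(A :: 'k::field mat) \<in> carrier_mat n m" "j < m"
  shows "A *\<^sub>v unit_vec m j = col A j"
proof -
  have "A *\<^sub>v unit_vec m j = A *\<^sub>v col (1\<^sub>m m) j" using assms(2) by simp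
  also have "\<dots> = col (A * 1\<^sub>m m) j" using assms by (intro col_mult2[symmetric]) auto
  finally show ?thesis unfolding right_mult_one_mat[OF assms(1)] .
qed

lemma col_mult_mat3:
  assumes "A \<in> carrier_mat n n" "B \<in> carrier_mat n n" "C \<in> carrier_mat n n" "j < n"
  shows "col (A * B * C) j = A *\<^sub>v (B *\<^sub>v col C j)"
proof -
  have AB: "A * B \<in> carrier_mat n n" and v: "col C j \<in> carrier_vec n"
    using assms by (auto simp: carrier_vecI)
  show ?thesis
    unfolding col_mult2[OF AB assms(3,4)] by (rule assoc_mult_mat_vec[OF assms(1,2) v])
qed

lemma mat_eq_if_mult_vec_eq:
  assumes A: "(A :: 'k::field mat) \<in> carrier_mat n m" and B: "B \<in> carrier_mat n m"
    and eq: "\<And>v. v \<in> carrier_vec m \<Longrightarrow> A *\<^sub>v v = B *\<^sub>v v"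
  shows "A = B"
proof (rule mat_col_eqI)
  fix j assume "j < dim_col B"
  then have "j < m" using B by simp
  then show "col A j = col B j"
    using eq[of "unit_vec m j"] mult_unit_vec_eq_col[OF A] mult_unit_vec_eq_col[OF B] by simp
qed (use A B in auto)

lemma vec_eq_0_if_coordinates_eq_0:
  assumes "(P :: 'k::field mat) \<in> carrier_mat n n" "Q \<in> carrier_mat n n" "P * Q = 1\<^sub>m n" "v \<in> carrier_vec n"
    and 0: "\<And>i. i < n \<Longrightarrow> (Q *\<^sub>v v) $ i = 0"
  shows "v = 0\<^sub>v n"
proof -
  have "Q *\<^sub>v v = 0\<^sub>v n" using assms(2) 0 by (intro eq_vecI) auto
  moreover have "P *\<^sub>v 0\<^sub>v n = 0\<^sub>v n" using assms(1) by (intro eq_vecI) auto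
  ultimately show ?thesis using mult_mat_vec_cancel[OF assms(1-4)] by simp
qed

lemma coordinates_of_col:
  assumes "(P :: 'k::field mat) \<in> carrier_mat n n" "Q \<in> carrier_mat n n" "Q * P = 1\<^sub>m n" "j < n"
  shows "Q *\<^sub>v col P j = unit_vec n j"
  unfolding col_mult2[OF assms(2,1,4), symmetric] assms(3) by (rule col_one[OF assms(4)])

text \<open>In coordinates adapted to the image, an idempotent has diagonal \<open>1, \<dots>, 1, 0, \<dots>, 0\<close>, so its trace
  is the dimension of the image; in characteristic zero that integer can be read off the trace.\<close>
lemma trace_idempotent_eq_0:
  fixes E :: "complex mat"
  assumes E: "E \<in> carrier_mat n n" and idem: "E * E = E" and tr: "trace E = 0"
  shows "E = 0\<^sub>m n n"
proof -
  let ?W = "{E *\<^sub>v v | v. v \<in> carrier_vec n}"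
  obtain k P Q where k: "k \<le> n" and P: "P \<in> carrier_mat n n" and Q: "Q \<in> carrier_mat n n"
    and PQ: "P * Q = 1\<^sub>m n" and QP: "Q * P = 1\<^sub>m n"
    and W: "\<And>v. v \<in> carrier_vec n \<Longrightarrow> v \<in> ?W \<longleftrightarrow> (\<forall>i<n. k \<le> i \<longrightarrow> (Q *\<^sub>v v) $ i = 0)"
    by (rule subspace_coordinates[OF subspace_image[OF E]]) (rule that)
  have fixW: "E *\<^sub>v w = w" if "w \<in> ?W" for w
  proof -
    from that obtain v where "v \<in> carrier_vec n" "w = E *\<^sub>v v" by auto
    then show ?thesis using idem assoc_mult_mat_vec[OF E E] by metis
  qed
  have diag: "(Q * E * P) $$ (i, i) = of_bool (i < k)" if i: "i < n" for i
  proof -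
    have Pi: "col P i \<in> carrier_vec n" using P by (simp add: carrier_vecI)
    note colM = col_mult_mat3[OF Q E P i]
    have idx: "(Q * E * P) $$ (i, i) = col (Q * E * P) i $ i" using P Q i by simp
    note Qcol = coordinates_of_col[OF P Q QP i]
    show ?thesis
    proof (cases "i < k")
      case True
      have "col P i \<in> ?W" unfolding W[OF Pi] using Qcol True i by simp
      from fixW[OF this] show ?thesis using idx colM Qcol True i by simp
    next
      case False
      have Ev: "E *\<^sub>v col P i \<in> carrier_vec n" using E Pi by simp
      have "E *\<^sub>v col P i \<in> ?W" using Pi by blast
      then have "(Q *\<^sub>v (E *\<^sub>v col P i)) $ i = 0"
        unfolding W[OF Ev] using i False by simp
      then show ?thesis using idx colM False by simp
    qed
  qed
  have "trace E = trace (Q * E * P)" using trace_conjugate[OF P Q E PQ] by simp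
  also have "\<dots> = (\<Sum>i<n. of_bool (i < k))" using diag Q by (simp add: trace_def)
  also have "\<dots> = of_nat (card ({..<n} \<inter> {i. i < k}))" by (simp add: of_bool_def sum.If_cases)
  also have "{..<n} \<inter> {i. i < k} = {..<k}" using k by auto
  finally have "k = 0" using tr by simp
  have zero: "E *\<^sub>v v = 0\<^sub>v n" if v: "v \<in> carrier_vec n" for v
  proof -
    have Ev: "E *\<^sub>v v \<in> carrier_vec n" using E v by auto
    have "E *\<^sub>v v \<in> ?W" using v by blast
    then show ?thesis
      unfolding W[OF Ev] using \<open>k = 0\<close> vec_eq_0_if_coordinates_eq_0[OF P Q PQ Ev] by simp
  qed
  show ?thesis
    using E zero by (intro mat_eq_if_mult_vec_eq) auto
qed

section \<open>Composition factors of matrix representations\<close>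

context group
begin

text \<open>A representation that need not be unital: \<open>\<rho> \<one>\<close> is only an idempotent. This admits the
  action of the group algebra on itself through the ideal generated by a central idempotent \<open>e\<close>,
  in the basis of group elements, without a choice of basis of that ideal.\<close>
definition matrix_semirep :: "nat \<Rightarrow> ('a \<Rightarrow> complex mat) \<Rightarrow> bool" where
  "matrix_semirep n \<rho> \<longleftrightarrow> (\<forall>g\<in>carrier G. \<rho> g \<in> carrier_mat n n) \<and>
     (\<forall>g\<in>carrier G. \<forall>h\<in>carrier G. \<rho> (g \<otimes> h) = \<rho> g * \<rho> h)"

lemma matrix_semirepD:
  assumes "matrix_semirep n \<rho>"
  shows "g \<in> carrier G \<Longrightarrow> \<rho> g \<in> carrier_mat n n"
    and "g \<in> carrier G \<Longrightarrow> h \<in> carrier G \<Longrightarrow> \<rho> (g \<otimes> h) = \<rho> g * \<rho> h"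
  using assms by (auto simp: matrix_semirep_def)

lemma representation_iff_unital_semirep:
  "representation G n \<rho> \<longleftrightarrow> matrix_semirep n \<rho> \<and> \<rho> \<one> = 1\<^sub>m n"
proof
  assume "representation G n \<rho>"
  then have hom: "\<rho> \<in> hom G (GL n)" by (simp add: representation_def)
  interpret R: monoid "ring_mat TYPE(complex) n ()"
    using ring_mat[of n "()"] ring.is_monoid by blast
  have "group (GL n)" unfolding GL_def by (rule R.units_group)
  then have "\<rho> \<one> = \<one>\<^bsub>GL n\<^esub>" using hom hom_one is_group by blast
  then have "\<rho> \<one> = 1\<^sub>m n" by (simp add: GL_def units_of_def ring_mat_simps)
  moreover have "matrix_semirep n \<rho>"
    using hom by (auto simp: matrix_semirep_def hom_def GL_def units_of_def Units_def ring_mat_simps Pi_iff)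
  ultimately show "matrix_semirep n \<rho> \<and> \<rho> \<one> = 1\<^sub>m n" by simp
next
  assume \<rho>: "matrix_semirep n \<rho> \<and> \<rho> \<one> = 1\<^sub>m n"
  then have mult: "\<rho> (g \<otimes> h) = \<rho> g * \<rho> h" if "g \<in> carrier G" "h \<in> carrier G" for g h
    using that matrix_semirepD by blast
  have "\<rho> g \<in> Units (ring_mat TYPE(complex) n ())" if g: "g \<in> carrier G" for g
  proof -
    have "\<rho> (inv g) * \<rho> g = 1\<^sub>m n" "\<rho> g * \<rho> (inv g) = 1\<^sub>m n"
      using mult[of "inv g" g] mult[of g "inv g"] g \<rho> by auto
    then show ?thesis
      using g \<rho> matrix_semirepD(1)[of n \<rho>] by (auto simp: Units_def ring_mat_simps)
  qed
  then show "representation G n \<rho>"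
    using mult by (auto simp: representation_def hom_def GL_def units_of_def ring_mat_simps)
qed

text \<open>The characteristic vector of \<open>A\<close> acts as the zero matrix.\<close>
definition vanishing_sum :: "nat \<Rightarrow> ('a \<Rightarrow> complex mat) \<Rightarrow> 'a set \<Rightarrow> bool" where
  "vanishing_sum n \<rho> A \<longleftrightarrow> (\<forall>i<n. \<forall>j<n. (\<Sum>a\<in>A. \<rho> a $$ (i, j)) = 0)"

definition invariant_subspace :: "nat \<Rightarrow> ('a \<Rightarrow> complex mat) \<Rightarrow> complex vec set \<Rightarrow> bool" where
  "invariant_subspace n \<rho> W \<longleftrightarrow>
     VectorSpace.subspace class_ring W (module_vec TYPE(complex) n) \<and>
     (\<forall>g\<in>carrier G. \<forall>w\<in>W. \<rho> g *\<^sub>v w \<in> W)"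

lemma semirep_conjugate:
  assumes "matrix_semirep n \<rho>" and P: "P \<in> carrier_mat n n" and Q: "Q \<in> carrier_mat n n"
    and PQ: "P * Q = 1\<^sub>m n"
  shows "matrix_semirep n (\<lambda>g. Q * \<rho> g * P)"
    and "A \<subseteq> carrier G \<Longrightarrow> vanishing_sum n \<rho> A \<Longrightarrow> vanishing_sum n (\<lambda>g. Q * \<rho> g * P) A"
    and "g \<in> carrier G \<Longrightarrow> trace (Q * \<rho> g * P) = trace (\<rho> g)"
proof -
  note \<rho> = matrix_semirepD[OF assms(1)]
  show "matrix_semirep n (\<lambda>g. Q * \<rho> g * P)"
    unfolding matrix_semirep_def
  proof (intro conjI ballI)
    fix g h assume g: "g \<in> carrier G" and h: "h \<in> carrier G"
    note c = \<rho>(1)[OF g] \<rho>(1)[OF h] P Q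
    have "Q * \<rho> g * P * (Q * \<rho> h * P) = Q * \<rho> g * (P * Q) * (\<rho> h * P)"
      using c by (simp add: assoc_mult_mat[of _ n n _ n _ n] mult_carrier_mat[of _ n n _ n])
    also have "\<dots> = Q * (\<rho> g * \<rho> h) * P"
      using c by (simp add: PQ assoc_mult_mat[of _ n n _ n _ n] mult_carrier_mat[of _ n n _ n])
    finally show "Q * \<rho> (g \<otimes> h) * P = Q * \<rho> g * P * (Q * \<rho> h * P)"
      using \<rho>(2)[OF g h] by simp
  qed (use P Q \<rho>(1) in \<open>simp add: mult_carrier_mat[of _ n n _ n]\<close>)
  show "vanishing_sum n (\<lambda>g. Q * \<rho> g * P) A" if A: "A \<subseteq> carrier G" and zero: "vanishing_sum n \<rho> A"
    unfolding vanishing_sum_def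
  proof (intro allI impI)
    fix i j assume ij: "i < n" "j < n"
    have "(\<Sum>a\<in>A. (Q * \<rho> a * P) $$ (i, j))
        = (\<Sum>a\<in>A. \<Sum>p<n. \<Sum>q<n. Q $$ (i, p) * \<rho> a $$ (p, q) * P $$ (q, j))"
      using A \<rho>(1) P Q ij by (intro sum.cong refl index_mult_mat3) auto
    also have "\<dots> = (\<Sum>p<n. \<Sum>q<n. Q $$ (i, p) * (\<Sum>a\<in>A. \<rho> a $$ (p, q)) * P $$ (q, j))"
      by (subst sum.swap, rule sum.cong[OF refl], subst sum.swap)
         (simp add: sum_distrib_left sum_distrib_right)
    also have "\<dots> = 0" using zero by (simp add: vanishing_sum_def)
    finally show "(\<Sum>a\<in>A. (Q * \<rho> a * P) $$ (i, j)) = 0" .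
  qed
  show "trace (Q * \<rho> g * P) = trace (\<rho> g)" if g: "g \<in> carrier G"
    using trace_conjugate[OF P Q \<rho>(1)[OF g] PQ] .
qed

text \<open>The diagonal blocks of a block triangular family are the actions on the invariant subspace and on
  the quotient by it.\<close>
lemma semirep_block_triangular:
  assumes "matrix_semirep n M" and k: "k \<le> n"
    and block: "\<And>g i j. g \<in> carrier G \<Longrightarrow> i < n \<Longrightarrow> k \<le> i \<Longrightarrow> j < k \<Longrightarrow> M g $$ (i, j) = 0"
  defines "S \<equiv> \<lambda>g. mat k k (\<lambda>(i, j). M g $$ (i, j))"
    and "R \<equiv> \<lambda>g. mat (n - k) (n - k) (\<lambda>(i, j). M g $$ (i + k, j + k))"
  shows "matrix_semirep k S" "matrix_semirep (n - k) R"
    and "vanishing_sum n M A \<Longrightarrow> vanishing_sum k S A"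
    and "vanishing_sum n M A \<Longrightarrow> vanishing_sum (n - k) R A"
    and "g \<in> carrier G \<Longrightarrow> trace (M g) = trace (S g) + trace (R g)"
proof -
  note M = matrix_semirepD[OF assms(1)]
  have split: "(\<Sum>l<n. f l) = (\<Sum>l<k. f l) + (\<Sum>l<n - k. f (l + k))" for f :: "nat \<Rightarrow> complex"
  proof -
    have "(\<Sum>l<n. f l) = (\<Sum>l\<in>{..<k} \<union> {k..<n}. f l)" using k by (intro sum.cong) auto
    also have "\<dots> = (\<Sum>l<k. f l) + (\<Sum>l\<in>{k..<n}. f l)" by (intro sum.union_disjoint) auto
    also have "(\<Sum>l\<in>{k..<n}. f l) = (\<Sum>l<n - k. f (l + k))"
      using k by (intro sum.reindex_bij_witness[of _ "\<lambda>l. l + k" "\<lambda>l. l - k"]) auto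
    finally show ?thesis .
  qed
  have Mij: "M (g \<otimes> h) $$ (i, j)
      = (\<Sum>l<k. M g $$ (i, l) * M h $$ (l, j)) + (\<Sum>l<n - k. M g $$ (i, l + k) * M h $$ (l + k, j))"
    if g: "g \<in> carrier G" and h: "h \<in> carrier G" and ij: "i < n" "j < n" for g h i j
    unfolding M(2)[OF g h] index_mult_mat_sum[OF M(1)[OF g] M(1)[OF h] ij] by (rule split)
  show "matrix_semirep k S"
    unfolding matrix_semirep_def
  proof (intro conjI ballI)
    fix g h assume g: "g \<in> carrier G" and h: "h \<in> carrier G"
    show "S (g \<otimes> h) = S g * S h"
    proof (rule eq_matI)
      fix i j assume "i < dim_row (S g * S h)" "j < dim_col (S g * S h)"
      then have ij: "i < k" "j < k" by (auto simp: S_def)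
      have "(S g * S h) $$ (i, j) = (\<Sum>l<k. M g $$ (i, l) * M h $$ (l, j))"
        using ij by (subst index_mult_mat_sum[of _ k k _ k]) (auto simp: S_def)
      moreover have "(\<Sum>l<n - k. M g $$ (i, l + k) * M h $$ (l + k, j)) = 0"
        using block[OF h] ij by (intro sum.neutral) auto
      ultimately show "S (g \<otimes> h) $$ (i, j) = (S g * S h) $$ (i, j)"
        using ij k Mij[OF g h, of i j] by (simp add: S_def)
    qed (auto simp: S_def)
  qed (simp add: S_def)
  show "matrix_semirep (n - k) R"
    unfolding matrix_semirep_def
  proof (intro conjI ballI)
    fix g h assume g: "g \<in> carrier G" and h: "h \<in> carrier G"
    show "R (g \<otimes> h) = R g * R h"
    proof (rule eq_matI)
      fix i j assume "i < dim_row (R g * R h)" "j < dim_col (R g * R h)"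
      then have ij: "i < n - k" "j < n - k" by (auto simp: R_def)
      have "(R g * R h) $$ (i, j) = (\<Sum>l<n - k. M g $$ (i + k, l + k) * M h $$ (l + k, j + k))"
        using ij by (subst index_mult_mat_sum[of _ "n - k" "n - k" _ "n - k"]) (auto simp: R_def)
      moreover have "(\<Sum>l<k. M g $$ (i + k, l) * M h $$ (l, j + k)) = 0"
        using block[OF g] ij by (intro sum.neutral) auto
      ultimately show "R (g \<otimes> h) $$ (i, j) = (R g * R h) $$ (i, j)"
        using ij Mij[OF g h, of "i + k" "j + k"] by (simp add: R_def)
    qed (auto simp: R_def)
  qed (simp add: R_def)
  show "vanishing_sum n M A \<Longrightarrow> vanishing_sum k S A"
    using k by (simp add: vanishing_sum_def S_def)
  show "vanishing_sum n M A \<Longrightarrow> vanishing_sum (n - k) R A"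
    by (simp add: vanishing_sum_def R_def)
  show "trace (M g) = trace (S g) + trace (R g)" if g: "g \<in> carrier G"
    using M(1)[OF g] by (simp add: trace_def split S_def R_def)
qed

lemma semirep_split:
  assumes \<rho>: "matrix_semirep n \<rho>" and inv: "invariant_subspace n \<rho> W"
    and nontriv: "W \<noteq> {0\<^sub>v n}" "W \<noteq> carrier_vec n"
  obtains k S R where "0 < k" "k < n" "matrix_semirep k S" "matrix_semirep (n - k) R"
    "\<And>A. A \<subseteq> carrier G \<Longrightarrow> vanishing_sum n \<rho> A \<Longrightarrow> vanishing_sum k S A \<and> vanishing_sum (n - k) R A"
    "\<And>g. g \<in> carrier G \<Longrightarrow> trace (\<rho> g) = trace (S g) + trace (R g)"
proof -
  have subspace: "VectorSpace.subspace class_ring W (module_vec TYPE(complex) n)"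
    using inv by (simp add: invariant_subspace_def)
  then have sub: "submodule class_ring W (module_vec TYPE(complex) n)"
    by (simp add: VectorSpace.subspace_def)
  have WC: "W \<subseteq> carrier_vec n" and W0: "0\<^sub>v n \<in> W"
    using submodule.subset[OF sub] submodule.zero_closed[OF sub] by (auto simp: module_vec_simps)
  obtain k P Q where k: "k \<le> n" and P: "P \<in> carrier_mat n n" and Q: "Q \<in> carrier_mat n n"
    and PQ: "P * Q = 1\<^sub>m n" and QP: "Q * P = 1\<^sub>m n"
    and mem: "\<And>v. v \<in> carrier_vec n \<Longrightarrow> v \<in> W \<longleftrightarrow> (\<forall>i<n. k \<le> i \<longrightarrow> (Q *\<^sub>v v) $ i = 0)"
    by (rule subspace_coordinates[OF subspace]) (rule that)
  have "k \<noteq> n"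
  proof
    assume "k = n"
    then have "carrier_vec n \<subseteq> W" using mem by (meson leD subsetI)
    then show False using nontriv WC by blast
  qed
  have "k \<noteq> 0"
  proof
    assume k0: "k = 0"
    have "v = 0\<^sub>v n" if "v \<in> W" for v
    proof -
      have v: "v \<in> carrier_vec n" using that WC by auto
      have "(Q *\<^sub>v v) $ i = 0" if "i < n" for i
        using mem[OF v] \<open>v \<in> W\<close> \<open>i < n\<close> k0 le0 by blast
      then show ?thesis by (rule vec_eq_0_if_coordinates_eq_0[OF P Q PQ v])
    qed
    then show False using nontriv W0 by blast
  qed
  have block: "(Q * \<rho> g * P) $$ (i, j) = 0"
    if g: "g \<in> carrier G" and i: "i < n" "k \<le> i" and j: "j < k" for g i j
  proof -
    note \<rho>g = matrix_semirepD(1)[OF \<rho> g]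
    have jn: "j < n" using j k by simp
    have Pj: "col P j \<in> carrier_vec n" using P by (simp add: carrier_vecI)
    have "col P j \<in> W" unfolding mem[OF Pj] using coordinates_of_col[OF P Q QP jn] j by simp
    then have inW: "\<rho> g *\<^sub>v col P j \<in> W" using inv g by (simp add: invariant_subspace_def)
    then have "\<rho> g *\<^sub>v col P j \<in> carrier_vec n" using WC by blast
    then have "(Q *\<^sub>v (\<rho> g *\<^sub>v col P j)) $ i = 0"
      using mem inW i by blast
    then have "col (Q * \<rho> g * P) j $ i = 0" using col_mult_mat3[OF Q \<rho>g P jn] by simp
    then show ?thesis using P Q i jn by simp
  qed
  let ?M = "\<lambda>g. Q * \<rho> g * P"
  note conj = semirep_conjugate[OF \<rho> P Q PQ]
  note tri = semirep_block_triangular[OF conj(1) k block]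
  show ?thesis
  proof (rule that[OF _ _ tri(1) tri(2)])
    show "0 < k" "k < n" using \<open>k \<noteq> 0\<close> \<open>k \<noteq> n\<close> k by simp_all
  next
    fix A assume "A \<subseteq> carrier G" "vanishing_sum n \<rho> A"
    note zero = conj(2)[OF this]
    show "vanishing_sum k (\<lambda>g. mat k k (\<lambda>(i, j). ?M g $$ (i, j))) A \<and>
        vanishing_sum (n - k) (\<lambda>g. mat (n - k) (n - k) (\<lambda>(i, j). ?M g $$ (i + k, j + k))) A"
      using tri(3)[OF _ _ _ _ zero] tri(4)[OF _ _ _ _ zero] by blast
  next
    fix g assume g: "g \<in> carrier G"
    show "trace (\<rho> g) = trace (mat k k (\<lambda>(i, j). ?M g $$ (i, j))) +
        trace (mat (n - k) (n - k) (\<lambda>(i, j). ?M g $$ (i + k, j + k)))"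
      unfolding conj(3)[OF g, symmetric] by (rule tri(5)[OF _ _ _ _ g])
  qed
qed

text \<open>A composition series, by induction on the dimension: a proper nonzero invariant subspace splits the
  trace into the traces on the subspace and on the quotient. If there is none, the image of \<open>\<rho> \<one>\<close>,
  which is invariant, is either zero, so that \<open>\<rho> = 0\<close>, or everything, so that \<open>\<rho>\<close> is unital and
  irreducible. The induction carries the matrix condition on \<open>A\<close> because the factors inherit it; the
  trace condition of the conclusion could cancel between them.\<close>
lemma composition_factor_characters:
  assumes "matrix_semirep n \<rho>" "A \<subseteq> carrier G" "vanishing_sum n \<rho> A"
  shows "\<exists>\<chi>s. set \<chi>s \<subseteq> {\<chi> \<in> Irr G. char_sum \<chi> A = 0} \<and>
           (\<forall>g\<in>carrier G. trace (\<rho> g) = (\<Sum>\<chi>\<leftarrow>\<chi>s. \<chi> g))"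
  using assms
proof (induction n arbitrary: \<rho> rule: less_induct)
  case (less n \<rho>)
  note \<rho> = matrix_semirepD[OF less.prems(1)]
  show ?case
  proof (cases "\<exists>W. invariant_subspace n \<rho> W \<and> W \<noteq> {0\<^sub>v n} \<and> W \<noteq> carrier_vec n")
    case True
    then obtain W where W: "invariant_subspace n \<rho> W" "W \<noteq> {0\<^sub>v n}" "W \<noteq> carrier_vec n" by blast
    obtain k S R where k: "0 < k" "k < n" and S: "matrix_semirep k S" and R: "matrix_semirep (n - k) R"
      and zeros: "vanishing_sum k S A" "vanishing_sum (n - k) R A"
      and tr: "\<And>g. g \<in> carrier G \<Longrightarrow> trace (\<rho> g) = trace (S g) + trace (R g)"
      using semirep_split[OF less.prems(1) W] less.prems(2,3) by metis
    obtain \<chi>s where \<chi>s: "set \<chi>s \<subseteq> {\<chi> \<in> Irr G. char_sum \<chi> A = 0}"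
        "\<And>g. g \<in> carrier G \<Longrightarrow> trace (S g) = (\<Sum>\<chi>\<leftarrow>\<chi>s. \<chi> g)"
      using less.IH[OF k(2) S less.prems(2) zeros(1)] by blast
    obtain \<psi>s where \<psi>s: "set \<psi>s \<subseteq> {\<chi> \<in> Irr G. char_sum \<chi> A = 0}"
        "\<And>g. g \<in> carrier G \<Longrightarrow> trace (R g) = (\<Sum>\<chi>\<leftarrow>\<psi>s. \<chi> g)"
      using less.IH[OF _ R less.prems(2) zeros(2)] k by auto
    show ?thesis
      using \<chi>s \<psi>s tr by (intro exI[of _ "\<chi>s @ \<psi>s"]) auto
  next
    case False
    let ?W = "{\<rho> \<one> *\<^sub>v v | v. v \<in> carrier_vec n}"
    have one: "\<rho> \<one> \<in> carrier_mat n n" using \<rho>(1) by simp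
    have "invariant_subspace n \<rho> ?W"
      unfolding invariant_subspace_def
    proof (intro conjI ballI)
      show "VectorSpace.subspace class_ring ?W (module_vec TYPE(complex) n)"
        by (rule subspace_image[OF one])
      fix g w assume g: "g \<in> carrier G" and "w \<in> ?W"
      then obtain v where v: "v \<in> carrier_vec n" "w = \<rho> \<one> *\<^sub>v v" by auto
      have "\<rho> g *\<^sub>v w = \<rho> g *\<^sub>v v"
        using assoc_mult_mat_vec[OF \<rho>(1)[OF g] one v(1)] \<rho>(2)[OF g one_closed] g v(2) by simp
      also have "\<dots> = \<rho> \<one> *\<^sub>v (\<rho> g *\<^sub>v v)"
        using assoc_mult_mat_vec[OF one \<rho>(1)[OF g] v(1)] \<rho>(2)[OF one_closed g] g by simp
      finally show "\<rho> g *\<^sub>v w \<in> ?W" using v \<rho>(1)[OF g] by auto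
    qed
    then have triv: "?W = {0\<^sub>v n} \<or> ?W = carrier_vec n" using False by blast
    have "?W = {0\<^sub>v n}" if n0: "n = 0"
    proof -
      have "carrier_vec n = {0\<^sub>v n :: complex vec}" using n0 by auto
      then show ?thesis using triv by (elim disjE) (simp_all only:)
    qed
    then consider "?W = {0\<^sub>v n}" | "?W = carrier_vec n" "n > 0"
      using triv by blast
    then show ?thesis
    proof cases
      case 1
      have "trace (\<rho> g) = 0" if g: "g \<in> carrier G" for g
      proof -
        have "\<rho> \<one> *\<^sub>v v = 0\<^sub>v n" if "v \<in> carrier_vec n" for v
          using 1 that by blast
        then have "\<rho> \<one> = 0\<^sub>m n n"
          using one by (intro mat_eq_if_mult_vec_eq) auto
        then have "\<rho> g = 0\<^sub>m n n" using \<rho>(2)[OF one_closed g] \<rho>(1)[OF g] g by simp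
        then show ?thesis by (simp add: trace_def)
      qed
      then show ?thesis by (intro exI[of _ "[]"]) auto
    next
      case 2
      have "\<rho> \<one> *\<^sub>v w = w" if w: "w \<in> carrier_vec n" for w
      proof -
        have "w \<in> ?W" using w 2 by simp
        then obtain v where v: "v \<in> carrier_vec n" "w = \<rho> \<one> *\<^sub>v v" by auto
        then show ?thesis
          using assoc_mult_mat_vec[OF one one v(1)] \<rho>(2)[OF one_closed one_closed] by simp
      qed
      then have "\<rho> \<one> = 1\<^sub>m n"
        using one by (intro mat_eq_if_mult_vec_eq) auto
      then have "irreducible_representation G n \<rho>"
        using 2 False less.prems(1)
        unfolding irreducible_representation_def representation_iff_unital_semirep invariant_subspace_def by blast
      then have irr: "character G \<rho> \<in> Irr G" unfolding Irr_def by blast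
      have "char_sum (character G \<rho>) A = (\<Sum>a\<in>A. \<Sum>i<n. \<rho> a $$ (i, i))"
        unfolding char_sum_def character_def trace_def using less.prems(2) \<rho>(1)
        by (intro sum.cong) auto
      also have "\<dots> = 0" using less.prems(3) by (subst sum.swap) (simp add: vanishing_sum_def)
      finally show ?thesis
        using irr by (intro exI[of _ "[character G \<rho>]"]) (auto simp: character_def)
    qed
  qed
qed

text \<open>The average of \<open>\<rho>\<close> over \<open>H\<close> is idempotent, and an idempotent of trace zero is zero.\<close>
lemma subgroup_sum_eq_0_if_character_sum_eq_0:
  assumes \<rho>: "matrix_semirep n \<rho>" and H: "subgroup H G" "finite H"
    and 0: "(\<Sum>h\<in>H. trace (\<rho> h)) = 0"
  shows "vanishing_sum n \<rho> H"
proof -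
  interpret H: subgroup H G by fact
  note \<rho> = matrix_semirepD[OF \<rho>]
  have H0: "card H \<noteq> 0" using H(2) H.one_closed by (metis card_0_eq empty_iff)
  define s where "s i j = (\<Sum>h\<in>H. \<rho> h $$ (i, j))" for i j
  define E where "E = mat n n (\<lambda>(i, j). s i j / of_nat (card H))"
  have E: "E \<in> carrier_mat n n" by (simp add: E_def)
  have "E * E = E"
  proof (rule eq_matI)
    fix i j assume "i < dim_row E" "j < dim_col E"
    then have ij: "i < n" "j < n" by (auto simp: E_def)
    have "(E * E) $$ (i, j) = (\<Sum>l<n. s i l * s l j) / (of_nat (card H))\<^sup>2"
      using ij by (subst index_mult_mat_sum[OF E E]) (auto simp: E_def sum_divide_distrib power2_eq_square)
    also have "(\<Sum>l<n. s i l * s l j)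
        = (\<Sum>h\<in>H. \<Sum>h'\<in>H. \<Sum>l<n. \<rho> h $$ (i, l) * \<rho> h' $$ (l, j))"
      unfolding s_def sum_product
      by (subst sum.swap, rule sum.cong[OF refl], subst sum.swap, rule refl)
    also have "\<dots> = (\<Sum>h\<in>H. \<Sum>h'\<in>H. \<rho> (h \<otimes> h') $$ (i, j))"
      using ij \<rho> by (intro sum.cong refl)
        (simp add: index_mult_mat_sum[of _ n n _ n] H.mem_carrier del: index_mult_mat(1))
    also have "\<dots> = (\<Sum>h\<in>H. \<Sum>h'\<in>H. \<rho> h' $$ (i, j))"
    proof (rule sum.cong[OF refl])
      fix h assume h: "h \<in> H"
      show "(\<Sum>h'\<in>H. \<rho> (h \<otimes> h') $$ (i, j)) = (\<Sum>h'\<in>H. \<rho> h' $$ (i, j))"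
        by (rule sum.reindex_bij_witness[of _ "\<lambda>x. inv h \<otimes> x" "\<lambda>x. h \<otimes> x"])
           (use h H.mem_carrier in \<open>auto simp flip: m_assoc\<close>)
    qed
    finally show "(E * E) $$ (i, j) = E $$ (i, j)"
      using ij H0 by (simp add: E_def s_def power2_eq_square)
  qed (auto simp: E_def)
  moreover have "trace E = 0"
  proof -
    have "trace E = (\<Sum>h\<in>H. \<Sum>i<n. \<rho> h $$ (i, i)) / of_nat (card H)"
      by (subst sum.swap) (simp add: trace_def E_def s_def sum_divide_distrib)
    also have "(\<Sum>h\<in>H. \<Sum>i<n. \<rho> h $$ (i, i)) = (\<Sum>h\<in>H. trace (\<rho> h))"
    proof (rule sum.cong[OF refl])
      fix h assume "h \<in> H"
      then show "(\<Sum>i<n. \<rho> h $$ (i, i)) = trace (\<rho> h)"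
        using carrier_matD(1)[OF \<rho>(1)[OF H.mem_carrier]] by (simp add: trace_def)
    qed
    finally show ?thesis using 0 by simp
  qed
  ultimately have "E = 0\<^sub>m n n" using trace_idempotent_eq_0[OF E] by blast
  then have "E $$ (i, j) = 0" if "i < n" "j < n" for i j using that by simp
  then show ?thesis using H0 by (simp add: vanishing_sum_def E_def s_def)
qed

lemma trace_sum_translate_eq_0:
  assumes "matrix_semirep n \<rho>" and A: "A \<subseteq> carrier G" "vanishing_sum n \<rho> A"
    and b: "b \<in> carrier G" and c: "c \<in> carrier G"
  shows "(\<Sum>h\<in>A. trace (\<rho> (b \<otimes> h \<otimes> c))) = 0"
proof -
  note \<rho> = matrix_semirepD[OF assms(1)]
  have tr: "trace (\<rho> (b \<otimes> h \<otimes> c)) = (\<Sum>i<n. \<Sum>p<n. \<Sum>q<n. \<rho> b $$ (i, p) * \<rho> h $$ (p, q) * \<rho> c $$ (q, i))"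
    if h: "h \<in> carrier G" for h
  proof -
    have "\<rho> (b \<otimes> h \<otimes> c) = \<rho> b * \<rho> h * \<rho> c" using \<rho>(2) b c h by simp
    moreover have "dim_row (\<rho> (b \<otimes> h \<otimes> c)) = n" using \<rho>(1)[of "b \<otimes> h \<otimes> c"] b c h by simp
    ultimately show ?thesis
      using index_mult_mat3[OF \<rho>(1)[OF b] \<rho>(1)[OF h] \<rho>(1)[OF c]]
      unfolding trace_def by (metis (no_types, lifting) lessThan_iff sum.cong)
  qed
  have "(\<Sum>h\<in>A. trace (\<rho> (b \<otimes> h \<otimes> c)))
      = (\<Sum>h\<in>A. \<Sum>i<n. \<Sum>p<n. \<Sum>q<n. \<rho> b $$ (i, p) * \<rho> h $$ (p, q) * \<rho> c $$ (q, i))"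
    using tr A by (intro sum.cong) auto
  also have "\<dots> = (\<Sum>i<n. \<Sum>p<n. \<Sum>q<n. \<Sum>h\<in>A. \<rho> b $$ (i, p) * \<rho> h $$ (p, q) * \<rho> c $$ (q, i))"
    by (subst sum.swap, rule sum.cong[OF refl], subst sum.swap, rule sum.cong[OF refl],
        subst sum.swap, rule refl)
  also have "\<dots> = (\<Sum>i<n. \<Sum>p<n. \<Sum>q<n. \<rho> b $$ (i, p) * (\<Sum>h\<in>A. \<rho> h $$ (p, q)) * \<rho> c $$ (q, i))"
    by (simp add: sum_distrib_left sum_distrib_right)
  also have "\<dots> = 0" using A(2) by (simp add: vanishing_sum_def)
  finally show ?thesis .
qed

end

section \<open>Orthogonal residuals\<close>

text \<open>Orthogonal projection onto the span of finitely many functions that may be linearly dependent,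
  by Gram--Schmidt: project \<open>f\<close> and the new function \<open>u k\<close> off the old ones, then remove from the
  residual of \<open>f\<close> its component along the residual of \<open>u k\<close>.\<close>
lemma exists_orthogonal_residual:
  fixes u :: "'i \<Rightarrow> 'a \<Rightarrow> real"
  assumes "finite X" "finite I"
  shows "\<exists>c. \<forall>i\<in>I. (\<Sum>x\<in>X. u i x * (f x - (\<Sum>j\<in>I. c j * u j x))) = 0"
  using assms(2)
proof (induction I arbitrary: f)
  case empty
  then show ?case by simp
next
  case (insert k I)
  obtain d where d: "\<forall>i\<in>I. (\<Sum>x\<in>X. u i x * (u k x - (\<Sum>j\<in>I. d j * u j x))) = 0"
    using insert.IH by blast
  obtain c where c: "\<forall>i\<in>I. (\<Sum>x\<in>X. u i x * (f x - (\<Sum>j\<in>I. c j * u j x))) = 0"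
    using insert.IH by blast
  define r where "r x = f x - (\<Sum>j\<in>I. c j * u j x)" for x
  define s where "s x = u k x - (\<Sum>j\<in>I. d j * u j x)" for x
  have r: "(\<Sum>x\<in>X. u i x * r x) = 0" and s: "(\<Sum>x\<in>X. u i x * s x) = 0" if "i \<in> I" for i
    using c d that by (simp_all add: r_def s_def)
  have uk: "u k x = s x + (\<Sum>j\<in>I. d j * u j x)" for x by (simp add: s_def)
  have expand: "(\<Sum>x\<in>X. u k x * g x) = (\<Sum>x\<in>X. s x * g x)"
    if g: "\<And>i. i \<in> I \<Longrightarrow> (\<Sum>x\<in>X. u i x * g x) = 0" for g
  proof -
    have "(\<Sum>x\<in>X. u k x * g x) = (\<Sum>x\<in>X. s x * g x) + (\<Sum>x\<in>X. \<Sum>j\<in>I. d j * (u j x * g x))"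
      unfolding uk by (simp add: distrib_right sum.distrib sum_distrib_right mult.assoc)
    also have "(\<Sum>x\<in>X. \<Sum>j\<in>I. d j * (u j x * g x)) = (\<Sum>j\<in>I. d j * (\<Sum>x\<in>X. u j x * g x))"
      by (subst sum.swap) (simp add: sum_distrib_left)
    also have "\<dots> = 0" using g by simp
    finally show ?thesis by simp
  qed
  define t where "t = (\<Sum>x\<in>X. s x * r x) / (\<Sum>x\<in>X. s x * s x)"
  define c' where "c' j = (if j = k then t else c j - t * d j)" for j
  have res: "f x - (\<Sum>j\<in>insert k I. c' j * u j x) = r x - t * s x" for x
  proof -
    have "(\<Sum>j\<in>I. c' j * u j x) = (\<Sum>j\<in>I. c j * u j x - t * (d j * u j x))"
      using insert.hyps by (intro sum.cong) (auto simp: c'_def algebra_simps)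
    also have "\<dots> = (\<Sum>j\<in>I. c j * u j x) - t * (\<Sum>j\<in>I. d j * u j x)"
      by (simp add: sum_subtractf sum_distrib_left)
    finally show ?thesis
      using insert.hyps by (simp add: c'_def r_def s_def algebra_simps)
  qed
  have lin: "(\<Sum>x\<in>X. g x * (r x - t * s x)) = (\<Sum>x\<in>X. g x * r x) - t * (\<Sum>x\<in>X. g x * s x)" for g
    by (simp add: right_diff_distrib sum_subtractf sum_distrib_left mult.left_commute)
  have orth: "(\<Sum>x\<in>X. u i x * (r x - t * s x)) = 0" if "i \<in> I" for i
    using r[OF that] s[OF that] by (simp add: lin)
  have "(\<Sum>x\<in>X. u k x * (r x - t * s x)) = (\<Sum>x\<in>X. s x * r x) - t * (\<Sum>x\<in>X. s x * s x)"
    using expand[of "\<lambda>x. r x - t * s x", OF orth] lin by simp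
  also have "\<dots> = 0"
  \<comment> \<open>If \<open>u k\<close> depends on the old functions, then \<open>t = 0\<close> by division by zero and both sums vanish.\<close>
  proof (cases "(\<Sum>x\<in>X. s x * s x) = 0")
    case True
    then have "s x = 0" if "x \<in> X" for x
      using that \<open>finite X\<close> by (simp add: sum_nonneg_eq_0_iff)
    then show ?thesis by simp
  qed (simp add: t_def)
  finally show ?case
    using orth res by (intro exI[of _ c']) auto
qed

section \<open>The central idempotent orthogonal to the canonical vectors\<close>

locale finite_group_action = group_action G \<Omega> \<phi>
  for G (structure) and \<Omega> and \<phi> +
  assumes finite_group: "finite (carrier G)" and finite_points: "finite \<Omega>"
begin

sublocale group G
  using group_hom group_hom.axioms(1) by blast

lemma action_closed: "g \<in> carrier G \<Longrightarrow> \<alpha> \<in> \<Omega> \<Longrightarrow> \<phi> g \<alpha> \<in> \<Omega>"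
  using element_image by blast

lemma action_inv: "g \<in> carrier G \<Longrightarrow> \<alpha> \<in> \<Omega> \<Longrightarrow> \<phi> (inv g) (\<phi> g \<alpha>) = \<alpha>"
  using orbit_sym_aux by blast

lemma action_inv': "g \<in> carrier G \<Longrightarrow> \<alpha> \<in> \<Omega> \<Longrightarrow> \<phi> g (\<phi> (inv g) \<alpha>) = \<alpha>"
  using action_inv[of "inv g" \<alpha>] by simp

lemma action_eq_iff:
  assumes "g \<in> carrier G" "\<alpha> \<in> \<Omega>" "\<beta> \<in> \<Omega>"
  shows "\<phi> g \<alpha> = \<beta> \<longleftrightarrow> \<alpha> = \<phi> (inv g) \<beta>"
  using assms action_inv action_inv' by metis

text \<open>The canonical vectors have real entries, so the bilinear pairing does the work of the Hermitian
  one and no conjugation appears.\<close>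
definition orthogonal_to_canonical :: "('a \<Rightarrow> 'k::comm_ring_1) \<Rightarrow> bool" where
  "orthogonal_to_canonical f \<longleftrightarrow>
     (\<forall>\<alpha>\<in>\<Omega>. \<forall>\<beta>\<in>\<Omega>. (\<Sum>t\<in>carrier G. f t * of_bool (\<phi> t \<alpha> = \<beta>)) = 0)"

lemma orthogonal_translate:
  assumes f: "orthogonal_to_canonical f" and "a \<in> carrier G" "b \<in> carrier G" "\<alpha> \<in> \<Omega>" "\<beta> \<in> \<Omega>"
  shows "(\<Sum>t\<in>carrier G. f t * of_bool (\<phi> (a \<otimes> t \<otimes> b) \<alpha> = \<beta>)) = 0"
proof -
  have "\<phi> (a \<otimes> t \<otimes> b) \<alpha> = \<beta> \<longleftrightarrow> \<phi> t (\<phi> b \<alpha>) = \<phi> (inv a) \<beta>" if "t \<in> carrier G" for t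
    using that assms by (simp add: composition_rule action_closed action_eq_iff)
  then have "(\<Sum>t\<in>carrier G. f t * of_bool (\<phi> (a \<otimes> t \<otimes> b) \<alpha> = \<beta>))
      = (\<Sum>t\<in>carrier G. f t * of_bool (\<phi> t (\<phi> b \<alpha>) = \<phi> (inv a) \<beta>))"
    by (intro sum.cong) auto
  also have "\<dots> = 0"
    using assms action_closed unfolding orthogonal_to_canonical_def by simp
  finally show ?thesis .
qed

lemma orthogonal_reflect:
  assumes f: "orthogonal_to_canonical f" and "a \<in> carrier G" "\<alpha> \<in> \<Omega>" "\<beta> \<in> \<Omega>"
  shows "(\<Sum>t\<in>carrier G. f (a \<otimes> inv t) * of_bool (\<phi> t \<alpha> = \<beta>)) = 0"
proof -
  have "(\<Sum>t\<in>carrier G. f (a \<otimes> inv t) * of_bool (\<phi> t \<alpha> = \<beta>))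
      = (\<Sum>t\<in>carrier G. f t * of_bool (\<phi> (inv t \<otimes> a) \<alpha> = \<beta>))"
    using assms
    by (intro sum.reindex_bij_witness[of _ "\<lambda>t. inv t \<otimes> a" "\<lambda>t. a \<otimes> inv t"])
       (auto simp: inv_mult_group m_assoc simp flip: m_assoc[of a])
  also have "\<dots> = (\<Sum>t\<in>carrier G. f t * of_bool (\<phi> t \<beta> = \<phi> a \<alpha>))"
  proof (rule sum.cong[OF refl])
    fix t assume t: "t \<in> carrier G"
    have "\<phi> (inv t \<otimes> a) \<alpha> = \<beta> \<longleftrightarrow> \<phi> a \<alpha> = \<phi> t \<beta>"
      using t assms action_eq_iff[of "inv t" "\<phi> a \<alpha>" \<beta>] by (simp add: composition_rule action_closed)
    then show "f t * of_bool (\<phi> (inv t \<otimes> a) \<alpha> = \<beta>) = f t * of_bool (\<phi> t \<beta> = \<phi> a \<alpha>)"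
      by (simp add: eq_commute)
  qed
  also have "\<dots> = 0"
    using assms action_closed unfolding orthogonal_to_canonical_def by simp
  finally show ?thesis .
qed

text \<open>The decomposition of the identity of the group algebra along the span of the canonical vectors.
  Real scalars make the pairing positive definite, which the uniqueness argument below needs.\<close>
lemma exists_real_idempotent:
  obtains e :: "'a \<Rightarrow> real" and c where
    "orthogonal_to_canonical e"
    "\<And>g. g \<in> carrier G \<Longrightarrow>
       of_bool (g = \<one>) = e g + (\<Sum>\<alpha>\<in>\<Omega>. \<Sum>\<beta>\<in>\<Omega>. c \<alpha> \<beta> * of_bool (\<phi> g \<alpha> = \<beta>))"
proof -
  let ?u = "\<lambda>p g. of_bool (\<phi> g (fst p) = snd p) :: real"
  obtain c where c: "\<forall>p\<in>\<Omega>\<times>\<Omega>. (\<Sum>g\<in>carrier G. ?u p g *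
      (of_bool (g = \<one>) - (\<Sum>q\<in>\<Omega>\<times>\<Omega>. c q * ?u q g))) = 0"
    using exists_orthogonal_residual[of "carrier G" "\<Omega>\<times>\<Omega>" ?u "\<lambda>g. of_bool (g = \<one>)"]
      finite_group finite_points by auto
  let ?e = "\<lambda>g. of_bool (g = \<one>) - (\<Sum>q\<in>\<Omega>\<times>\<Omega>. c q * ?u q g)"
  have "orthogonal_to_canonical ?e"
    using c by (simp add: orthogonal_to_canonical_def mult.commute)
  moreover have "of_bool (g = \<one>) = ?e g + (\<Sum>\<alpha>\<in>\<Omega>. \<Sum>\<beta>\<in>\<Omega>. c (\<alpha>, \<beta>) * of_bool (\<phi> g \<alpha> = \<beta>))" for g
    by (simp add: sum.cartesian_product case_prod_unfold)
  ultimately show ?thesis using that[of ?e "\<lambda>\<alpha> \<beta>. c (\<alpha>, \<beta>)"] by blast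
qed

text \<open>Conjugation permutes the canonical vectors, so the conjugate of \<open>e\<close> is another residual of the
  identity. The difference \<open>d\<close> of the two residuals is both in the span and orthogonal to it, hence
  zero.\<close>
lemma residual_class_function:
  fixes e :: "'a \<Rightarrow> real"
  assumes e: "orthogonal_to_canonical e"
    and c: "\<And>g. g \<in> carrier G \<Longrightarrow>
       of_bool (g = \<one>) = e g + (\<Sum>\<alpha>\<in>\<Omega>. \<Sum>\<beta>\<in>\<Omega>. c \<alpha> \<beta> * of_bool (\<phi> g \<alpha> = \<beta>))"
    and x: "x \<in> carrier G" and y: "y \<in> carrier G"
  shows "e (x \<otimes> y) = e (y \<otimes> x)"
proof -
  have cancel: "y \<otimes> (inv y \<otimes> g) = g" "inv y \<otimes> (y \<otimes> g) = g" if "g \<in> carrier G" for g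
    using y that by (simp_all flip: m_assoc)
  define d where "d g = e g - e (inv y \<otimes> g \<otimes> y)" for g
  have d0: "(\<Sum>t\<in>carrier G. d t * of_bool (\<phi> t \<alpha> = \<beta>)) = 0" if "\<alpha> \<in> \<Omega>" "\<beta> \<in> \<Omega>" for \<alpha> \<beta>
  proof -
    have "(\<Sum>t\<in>carrier G. e (inv y \<otimes> t \<otimes> y) * of_bool (\<phi> t \<alpha> = \<beta>))
        = (\<Sum>t\<in>carrier G. e t * of_bool (\<phi> (y \<otimes> t \<otimes> inv y) \<alpha> = \<beta>))"
      using y by (intro sum.reindex_bij_witness[of _ "\<lambda>t. y \<otimes> t \<otimes> inv y" "\<lambda>t. inv y \<otimes> t \<otimes> y"])
        (auto simp: m_assoc cancel)
    also have "\<dots> = 0" using orthogonal_translate[OF e] y that by simp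
    finally show ?thesis
      using e that by (simp add: d_def left_diff_distrib sum_subtractf orthogonal_to_canonical_def)
  qed
  then have d: "orthogonal_to_canonical d" by (simp add: orthogonal_to_canonical_def)
  have dspan: "d g = (\<Sum>\<alpha>\<in>\<Omega>. \<Sum>\<beta>\<in>\<Omega>. c \<alpha> \<beta> *
      (of_bool (\<phi> (inv y \<otimes> g \<otimes> y) \<alpha> = \<beta>) - of_bool (\<phi> (\<one> \<otimes> g \<otimes> \<one>) \<alpha> = \<beta>)))" if g: "g \<in> carrier G" for g
  proof -
    have "inv y \<otimes> g \<otimes> y = \<one> \<longleftrightarrow> g = \<one>"
    proof
      assume "inv y \<otimes> g \<otimes> y = \<one>"
      then have "y \<otimes> (inv y \<otimes> g \<otimes> y) \<otimes> inv y = y \<otimes> \<one> \<otimes> inv y" by simp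
      then show "g = \<one>" using g y by (simp add: m_assoc flip: m_assoc[of y])
    qed (use y in simp)
    then have "(of_bool (inv y \<otimes> g \<otimes> y = \<one>) :: real) = of_bool (g = \<one>)" by simp
    then show ?thesis
      using c[of g] c[of "inv y \<otimes> g \<otimes> y"] g y
      by (simp add: d_def right_diff_distrib sum_subtractf)
  qed
  have "(\<Sum>g\<in>carrier G. d g * d g) = (\<Sum>g\<in>carrier G. \<Sum>\<alpha>\<in>\<Omega>. \<Sum>\<beta>\<in>\<Omega>. c \<alpha> \<beta> *
      (d g * of_bool (\<phi> (inv y \<otimes> g \<otimes> y) \<alpha> = \<beta>) - d g * of_bool (\<phi> (\<one> \<otimes> g \<otimes> \<one>) \<alpha> = \<beta>)))"
    by (rule sum.cong[OF refl], subst (2) dspan)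
       (simp_all add: sum_distrib_left right_diff_distrib mult.left_commute)
  also have "\<dots> = (\<Sum>\<alpha>\<in>\<Omega>. \<Sum>\<beta>\<in>\<Omega>. c \<alpha> \<beta> *
      ((\<Sum>g\<in>carrier G. d g * of_bool (\<phi> (inv y \<otimes> g \<otimes> y) \<alpha> = \<beta>))
       - (\<Sum>g\<in>carrier G. d g * of_bool (\<phi> (\<one> \<otimes> g \<otimes> \<one>) \<alpha> = \<beta>))))"
    by (subst sum.swap, rule sum.cong[OF refl], subst sum.swap)
       (simp add: sum_subtractf flip: sum_distrib_left)
  also have "\<dots> = 0"
    using orthogonal_translate[OF d] d0 y by (intro sum.neutral ballI) simp
  finally have "\<forall>g\<in>carrier G. d g * d g = 0"
    using finite_group by (subst (asm) sum_nonneg_eq_0_iff) auto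
  then have "d (y \<otimes> x) = 0" using x y by auto
  moreover have "inv y \<otimes> (y \<otimes> x) \<otimes> y = x \<otimes> y" using x y by (simp flip: m_assoc[of "inv y" y])
  ultimately show ?thesis by (simp add: d_def)
qed

text \<open>Convolution with \<open>e\<close> fixes everything orthogonal to the canonical vectors: \<open>e\<close> differs from the
  identity by an element of the span, and convolving with a canonical vector means pairing with
  another one. For \<open>f = e\<close> this says that \<open>e\<close> is idempotent.\<close>
lemma residual_convolution:
  fixes e :: "'a \<Rightarrow> 'k::comm_ring_1"
  assumes f: "orthogonal_to_canonical f"
    and c: "\<And>g. g \<in> carrier G \<Longrightarrow>
       of_bool (g = \<one>) = e g + (\<Sum>\<alpha>\<in>\<Omega>. \<Sum>\<beta>\<in>\<Omega>. c \<alpha> \<beta> * of_bool (\<phi> g \<alpha> = \<beta>))"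
    and a: "a \<in> carrier G"
  shows "(\<Sum>t\<in>carrier G. f (a \<otimes> inv t) * e t) = f a"
proof -
  have e: "e g = of_bool (g = \<one>) - (\<Sum>\<alpha>\<in>\<Omega>. \<Sum>\<beta>\<in>\<Omega>. c \<alpha> \<beta> * of_bool (\<phi> g \<alpha> = \<beta>))"
    if "g \<in> carrier G" for g using c[OF that] by simp
  have "(\<Sum>t\<in>carrier G. f (a \<otimes> inv t) * e t) = (\<Sum>t\<in>carrier G. f (a \<otimes> inv t) * of_bool (t = \<one>))
     - (\<Sum>t\<in>carrier G. \<Sum>\<alpha>\<in>\<Omega>. \<Sum>\<beta>\<in>\<Omega>. c \<alpha> \<beta> * (f (a \<otimes> inv t) * of_bool (\<phi> t \<alpha> = \<beta>)))"
    by (simp add: e right_diff_distrib sum_subtractf sum_distrib_left mult.left_commute)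
  also have "(\<Sum>t\<in>carrier G. \<Sum>\<alpha>\<in>\<Omega>. \<Sum>\<beta>\<in>\<Omega>. c \<alpha> \<beta> * (f (a \<otimes> inv t) * of_bool (\<phi> t \<alpha> = \<beta>)))
     = (\<Sum>\<alpha>\<in>\<Omega>. \<Sum>\<beta>\<in>\<Omega>. c \<alpha> \<beta> * (\<Sum>t\<in>carrier G. f (a \<otimes> inv t) * of_bool (\<phi> t \<alpha> = \<beta>)))"
    by (subst sum.swap, rule sum.cong[OF refl], subst sum.swap) (simp add: sum_distrib_left)
  also have "\<dots> = 0"
    using orthogonal_reflect[OF f a] by (intro sum.neutral ballI) simp
  also have "(\<Sum>t\<in>carrier G. f (a \<otimes> inv t) * of_bool (t = \<one>)) = (\<Sum>t\<in>{\<one>}. f (a \<otimes> inv t))"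
    using finite_group by (intro sum.mono_neutral_cong_right) auto
  finally show ?thesis using a by simp
qed

lemma exists_canonical_idempotent:
  obtains e :: "'a \<Rightarrow> complex" and c where
    "orthogonal_to_canonical e"
    "\<And>g. g \<in> carrier G \<Longrightarrow>
       of_bool (g = \<one>) = e g + (\<Sum>\<alpha>\<in>\<Omega>. \<Sum>\<beta>\<in>\<Omega>. c \<alpha> \<beta> * of_bool (\<phi> g \<alpha> = \<beta>))"
    "\<And>x y. x \<in> carrier G \<Longrightarrow> y \<in> carrier G \<Longrightarrow> e (x \<otimes> y) = e (y \<otimes> x)"
    "\<And>a. a \<in> carrier G \<Longrightarrow> (\<Sum>t\<in>carrier G. e (a \<otimes> inv t) * e t) = e a"
proof -
  obtain e :: "'a \<Rightarrow> real" and c where e: "orthogonal_to_canonical e"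
    and c: "\<And>g. g \<in> carrier G \<Longrightarrow>
       of_bool (g = \<one>) = e g + (\<Sum>\<alpha>\<in>\<Omega>. \<Sum>\<beta>\<in>\<Omega>. c \<alpha> \<beta> * of_bool (\<phi> g \<alpha> = \<beta>))"
    using exists_real_idempotent by blast
  let ?e = "\<lambda>g. complex_of_real (e g)" and ?c = "\<lambda>\<alpha> \<beta>. complex_of_real (c \<alpha> \<beta>)"
  have of_bool: "complex_of_real (of_bool P) = of_bool P" for P by (cases P) simp_all
  have e': "orthogonal_to_canonical ?e"
    unfolding orthogonal_to_canonical_def
  proof (intro ballI)
    fix \<alpha> \<beta> assume "\<alpha> \<in> \<Omega>" "\<beta> \<in> \<Omega>"
    then have "complex_of_real (\<Sum>t\<in>carrier G. e t * of_bool (\<phi> t \<alpha> = \<beta>)) = 0"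
      using e unfolding orthogonal_to_canonical_def by simp
    then show "(\<Sum>t\<in>carrier G. ?e t * of_bool (\<phi> t \<alpha> = \<beta>)) = 0"
      by (simp add: of_bool)
  qed
  have c': "of_bool (g = \<one>) = ?e g + (\<Sum>\<alpha>\<in>\<Omega>. \<Sum>\<beta>\<in>\<Omega>. ?c \<alpha> \<beta> * of_bool (\<phi> g \<alpha> = \<beta>))"
    if "g \<in> carrier G" for g
    using arg_cong[OF c[OF that], of complex_of_real] by (simp add: of_bool)
  show ?thesis
    by (rule that[OF e' c' _ residual_convolution[OF e' c']])
       (use residual_class_function[OF e c] in auto)
qed

section \<open>Characters and the span of the canonical vectors\<close>

text \<open>The family \<open>\<rho>\<close> is left multiplication by \<open>g e\<close> on the group algebra in the basis of group elements,
  so \<open>tr \<rho>(g) = |G| e(g\<^sup>-\<^sup>1)\<close>, and the stabilizer of \<open>\<omega>\<close> acts as zero because \<open>e\<close> is orthogonal to the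
  canonical vectors. Its composition factors are thus among the characters of the hypothesis, which
  turns the hypothesis into \<open>f e = 0\<close>; then \<open>f = f (1 - e)\<close> lies in the ideal spanned by the canonical
  vectors.\<close>
lemma canonical_span_if_characters_vanish:
  assumes \<omega>: "\<omega> \<in> \<Omega>"
    and van: "\<And>\<chi> g. \<chi> \<in> Irr G \<Longrightarrow> char_sum \<chi> (stabilizer G \<phi> \<omega>) = 0 \<Longrightarrow> g \<in> carrier G \<Longrightarrow>
      (\<Sum>t\<in>carrier G. f t * \<chi> (t \<otimes> g)) = 0"
  obtains c where "\<And>g. g \<in> carrier G \<Longrightarrow>
    f g = (\<Sum>\<alpha>\<in>\<Omega>. \<Sum>\<beta>\<in>\<Omega>. c \<alpha> \<beta> * of_bool (\<phi> g \<alpha> = \<beta>))"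
proof -
  obtain e :: "'a \<Rightarrow> complex" and c where e: "orthogonal_to_canonical e"
    and c: "\<And>g. g \<in> carrier G \<Longrightarrow>
       of_bool (g = \<one>) = e g + (\<Sum>\<alpha>\<in>\<Omega>. \<Sum>\<beta>\<in>\<Omega>. c \<alpha> \<beta> * of_bool (\<phi> g \<alpha> = \<beta>))"
    and comm: "\<And>x y. x \<in> carrier G \<Longrightarrow> y \<in> carrier G \<Longrightarrow> e (x \<otimes> y) = e (y \<otimes> x)"
    and conv: "\<And>a. a \<in> carrier G \<Longrightarrow> (\<Sum>t\<in>carrier G. e (a \<otimes> inv t) * e t) = e a"
    using exists_canonical_idempotent by blast
  define N where "N = card (carrier G)"
  have "N \<noteq> 0" using finite_group by (auto simp: N_def)
  obtain k where k: "bij_betw k {..<N} (carrier G)"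
    using ex_bij_betw_nat_finite[OF finite_group] by (auto simp: N_def lessThan_atLeast0)
  have kG: "k i \<in> carrier G" if "i < N" for i using bij_betwE[OF k] that by simp
  define \<rho> where "\<rho> g = mat N N (\<lambda>(i, j). e (inv g \<otimes> k i \<otimes> inv k j))" for g
  have \<rho>: "\<rho> g \<in> carrier_mat N N" for g by (simp add: \<rho>_def)
  have semirep: "matrix_semirep N \<rho>"
    unfolding matrix_semirep_def
  proof (intro conjI ballI \<rho>)
    fix g h assume g: "g \<in> carrier G" and h: "h \<in> carrier G"
    show "\<rho> (g \<otimes> h) = \<rho> g * \<rho> h"
    proof (rule eq_matI)
      fix i j assume "i < dim_row (\<rho> g * \<rho> h)" "j < dim_col (\<rho> g * \<rho> h)"
      then have ij: "i < N" "j < N" by (auto simp: \<rho>_def)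
      let ?a = "inv g \<otimes> k i" and ?b = "inv k j \<otimes> inv h"
      have a: "?a \<in> carrier G" and b: "?b \<in> carrier G" using g h ij kG by auto
      have "(\<rho> g * \<rho> h) $$ (i, j) = (\<Sum>l<N. e (?a \<otimes> inv k l) * e (inv h \<otimes> k l \<otimes> inv k j))"
        using ij by (subst index_mult_mat_sum[OF \<rho> \<rho>]) (auto simp: \<rho>_def)
      also have "\<dots> = (\<Sum>t\<in>carrier G. e (?a \<otimes> inv t) * e (inv h \<otimes> t \<otimes> inv k j))"
        by (rule sum.reindex_bij_betw[OF k])
      also have "\<dots> = (\<Sum>t\<in>carrier G. e (?a \<otimes> inv t) * e (t \<otimes> ?b))"
      proof (rule sum.cong[OF refl])
        fix t assume t: "t \<in> carrier G"
        have "e (inv h \<otimes> t \<otimes> inv k j) = e (inv h \<otimes> (t \<otimes> inv k j))"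
          using t h ij kG by (simp add: m_assoc)
        also have "\<dots> = e (t \<otimes> inv k j \<otimes> inv h)"
          using t h ij kG by (intro comm) auto
        finally show "e (?a \<otimes> inv t) * e (inv h \<otimes> t \<otimes> inv k j) = e (?a \<otimes> inv t) * e (t \<otimes> ?b)"
          using t h ij kG by (simp add: m_assoc)
      qed
      also have "\<dots> = (\<Sum>t\<in>carrier G. e (?a \<otimes> ?b \<otimes> inv t) * e t)"
      proof (rule sum.reindex_bij_witness[of _ "\<lambda>t. t \<otimes> inv ?b" "\<lambda>t. t \<otimes> ?b"])
        fix t assume t: "t \<in> carrier G"
        show "t \<otimes> ?b \<otimes> inv ?b = t" "t \<otimes> inv ?b \<otimes> ?b = t"
          using t m_assoc[OF t b inv_closed[OF b]] m_assoc[OF t inv_closed[OF b] b] b by simp_all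
        show "t \<otimes> ?b \<in> carrier G" "t \<otimes> inv ?b \<in> carrier G" using t b by blast+
        have "?a \<otimes> ?b \<otimes> inv (t \<otimes> ?b) = ?a \<otimes> (?b \<otimes> inv ?b) \<otimes> inv t"
          using t a b by (simp only: inv_mult_group m_assoc inv_closed m_closed)
        also have "\<dots> = ?a \<otimes> inv t" using a b by simp
        finally show "e (?a \<otimes> ?b \<otimes> inv (t \<otimes> ?b)) * e (t \<otimes> ?b) = e (?a \<otimes> inv t) * e (t \<otimes> ?b)" by simp
      qed
      also have "\<dots> = e (?a \<otimes> ?b)" using a b by (intro conv) simp
      also have "\<dots> = e (?a \<otimes> inv k j \<otimes> inv h)"
        using a h ij kG by (simp add: m_assoc)
      also have "\<dots> = e (inv h \<otimes> (?a \<otimes> inv k j))"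
        using a h ij kG by (intro comm) auto
      also have "inv h \<otimes> (?a \<otimes> inv k j) = inv (g \<otimes> h) \<otimes> k i \<otimes> inv k j"
        using g h ij kG by (simp add: inv_mult_group m_assoc)
      finally show "\<rho> (g \<otimes> h) $$ (i, j) = (\<rho> g * \<rho> h) $$ (i, j)"
        using ij by (simp add: \<rho>_def)
    qed (auto simp: \<rho>_def)
  qed
  let ?H = "stabilizer G \<phi> \<omega>"
  have HG: "?H \<subseteq> carrier G" by (auto simp: stabilizer_def)
  have zero: "vanishing_sum N \<rho> ?H"
    unfolding vanishing_sum_def
  proof (intro allI impI)
    fix i j assume ij: "i < N" "j < N"
    define x where "x = k i \<otimes> inv k j"
    have x: "x \<in> carrier G" using ij kG by (simp add: x_def)
    have "(\<Sum>h\<in>?H. \<rho> h $$ (i, j)) = (\<Sum>h\<in>?H. e (inv h \<otimes> x))"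
      using ij kG HG by (intro sum.cong) (auto simp: \<rho>_def x_def m_assoc)
    also have "\<dots> = (\<Sum>h\<in>carrier G. e (inv h \<otimes> x) * of_bool (\<phi> h \<omega> = \<omega>))"
      using finite_group by (intro sum.mono_neutral_cong_left) (auto simp: stabilizer_def)
    also have "\<dots> = (\<Sum>h\<in>carrier G. e (x \<otimes> inv h) * of_bool (\<phi> h \<omega> = \<omega>))"
      using comm x by (intro sum.cong) auto
    also have "\<dots> = 0" by (rule orthogonal_reflect[OF e x \<omega> \<omega>])
    finally show "(\<Sum>h\<in>?H. \<rho> h $$ (i, j)) = 0" .
  qed
  have tr: "trace (\<rho> g) = of_nat N * e (inv g)" if g: "g \<in> carrier G" for g
    using g kG by (simp add: trace_def \<rho>_def m_assoc)
  obtain \<chi>s where \<chi>s: "set \<chi>s \<subseteq> {\<chi> \<in> Irr G. char_sum \<chi> ?H = 0}"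
    and tr\<chi>: "\<And>g. g \<in> carrier G \<Longrightarrow> trace (\<rho> g) = (\<Sum>\<chi>\<leftarrow>\<chi>s. \<chi> g)"
    using composition_factor_characters[OF semirep HG zero] by blast
  have list0: "(\<Sum>t\<in>carrier G. f t * (\<Sum>\<chi>\<leftarrow>xs. \<chi> (t \<otimes> g))) = 0"
    if "set xs \<subseteq> {\<chi> \<in> Irr G. char_sum \<chi> ?H = 0}" "g \<in> carrier G" for xs g
    using that van by (induction xs) (auto simp: distrib_left sum.distrib)
  have conv0: "(\<Sum>t\<in>carrier G. f t * e (inv t \<otimes> g)) = 0" if g: "g \<in> carrier G" for g
  proof -
    have "of_nat N * (\<Sum>t\<in>carrier G. f t * e (inv t \<otimes> g))
        = (\<Sum>t\<in>carrier G. f t * trace (\<rho> (t \<otimes> inv g)))"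
      unfolding sum_distrib_left
    proof (rule sum.cong[OF refl])
      fix t assume t: "t \<in> carrier G"
      have "e (inv (t \<otimes> inv g)) = e (g \<otimes> inv t)" using t g by (simp add: inv_mult_group)
      also have "\<dots> = e (inv t \<otimes> g)" using t g by (intro comm) auto
      finally show "of_nat N * (f t * e (inv t \<otimes> g)) = f t * trace (\<rho> (t \<otimes> inv g))"
        using tr[of "t \<otimes> inv g"] t g by simp
    qed
    also have "\<dots> = (\<Sum>t\<in>carrier G. f t * (\<Sum>\<chi>\<leftarrow>\<chi>s. \<chi> (t \<otimes> inv g)))"
      using tr\<chi> g by (intro sum.cong) auto
    also have "\<dots> = 0" using list0[OF \<chi>s] g by simp
    finally show ?thesis using \<open>N \<noteq> 0\<close> by simp
  qed
  define d where "d \<alpha> \<beta> = (\<Sum>t\<in>carrier G. f t * c \<alpha> (\<phi> (inv t) \<beta>))" for \<alpha> \<beta>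
  have "f g = (\<Sum>\<alpha>\<in>\<Omega>. \<Sum>\<beta>\<in>\<Omega>. d \<alpha> \<beta> * of_bool (\<phi> g \<alpha> = \<beta>))" if g: "g \<in> carrier G" for g
  proof -
    have single: "(\<Sum>t\<in>carrier G. f t * of_bool (inv t \<otimes> g = \<one>)) = f g"
    proof -
      have "inv t \<otimes> g = \<one> \<longleftrightarrow> t = g" if "t \<in> carrier G" for t
        using that g by (metis inv_equality inv_inv l_inv inv_closed)
      then have "(\<Sum>t\<in>carrier G. f t * of_bool (inv t \<otimes> g = \<one>)) = (\<Sum>t\<in>{g}. f t)"
        using finite_group g by (intro sum.mono_neutral_cong_right) auto
      then show ?thesis by simp
    qed
    have "f g = (\<Sum>t\<in>carrier G. f t * of_bool (inv t \<otimes> g = \<one>)) - (\<Sum>t\<in>carrier G. f t * e (inv t \<otimes> g))"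
      using single conv0[OF g] by simp
    also have "\<dots> = (\<Sum>t\<in>carrier G. f t * (of_bool (inv t \<otimes> g = \<one>) - e (inv t \<otimes> g)))"
      by (simp add: right_diff_distrib sum_subtractf)
    also have "\<dots> = (\<Sum>t\<in>carrier G. \<Sum>\<alpha>\<in>\<Omega>. \<Sum>\<beta>\<in>\<Omega>. f t * c \<alpha> (\<phi> (inv t) \<beta>) * of_bool (\<phi> g \<alpha> = \<beta>))"
    proof (rule sum.cong[OF refl])
      fix t assume t: "t \<in> carrier G"
      have "of_bool (inv t \<otimes> g = \<one>) - e (inv t \<otimes> g)
          = (\<Sum>\<alpha>\<in>\<Omega>. \<Sum>\<beta>\<in>\<Omega>. c \<alpha> \<beta> * of_bool (\<phi> (inv t \<otimes> g) \<alpha> = \<beta>))"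
        using c[of "inv t \<otimes> g"] t g by simp
      also have "\<dots> = (\<Sum>\<alpha>\<in>\<Omega>. \<Sum>\<beta>\<in>\<Omega>. c \<alpha> (\<phi> (inv t) \<beta>) * of_bool (\<phi> g \<alpha> = \<beta>))"
      proof (rule sum.cong[OF refl])
        fix \<alpha> assume \<alpha>: "\<alpha> \<in> \<Omega>"
        show "(\<Sum>\<beta>\<in>\<Omega>. c \<alpha> \<beta> * of_bool (\<phi> (inv t \<otimes> g) \<alpha> = \<beta>))
            = (\<Sum>\<beta>\<in>\<Omega>. c \<alpha> (\<phi> (inv t) \<beta>) * of_bool (\<phi> g \<alpha> = \<beta>))"
        proof (rule sum.reindex_bij_witness[of _ "\<phi> (inv t)" "\<phi> t"])
          fix \<beta> assume \<beta>: "\<beta> \<in> \<Omega>"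
          have "\<phi> (inv t \<otimes> g) \<alpha> = \<beta> \<longleftrightarrow> \<phi> g \<alpha> = \<phi> t \<beta>"
            using t g \<alpha> \<beta> action_eq_iff[of "inv t" "\<phi> g \<alpha>" \<beta>] by (simp add: composition_rule action_closed)
          then show "c \<alpha> (\<phi> (inv t) (\<phi> t \<beta>)) * of_bool (\<phi> g \<alpha> = \<phi> t \<beta>)
              = c \<alpha> \<beta> * of_bool (\<phi> (inv t \<otimes> g) \<alpha> = \<beta>)"
            using t \<beta> by (simp add: action_inv)
        qed (use t action_inv action_inv' action_closed in auto)
      qed
      finally show "f t * (of_bool (inv t \<otimes> g = \<one>) - e (inv t \<otimes> g))
          = (\<Sum>\<alpha>\<in>\<Omega>. \<Sum>\<beta>\<in>\<Omega>. f t * c \<alpha> (\<phi> (inv t) \<beta>) * of_bool (\<phi> g \<alpha> = \<beta>))"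
        by (simp only: sum_distrib_left mult.assoc)
    qed
    also have "\<dots> = (\<Sum>\<alpha>\<in>\<Omega>. \<Sum>\<beta>\<in>\<Omega>. \<Sum>t\<in>carrier G. f t * c \<alpha> (\<phi> (inv t) \<beta>) * of_bool (\<phi> g \<alpha> = \<beta>))"
      by (subst sum.swap, rule sum.cong[OF refl], subst sum.swap, rule refl)
    finally show ?thesis by (simp only: d_def sum_distrib_right)
  qed
  then show ?thesis by (rule that)
qed

text \<open>The elements that take \<open>\<phi> a \<omega>\<close> to \<open>\<phi> b \<omega>\<close> are \<open>b h a\<^sup>-\<^sup>1\<close> with \<open>h\<close> in the stabilizer of \<open>\<omega>\<close>, and the sum
  over the stabilizer acts as zero, not merely with trace zero.\<close>
lemma character_sum_canonical_eq_0:
  assumes \<omega>: "\<omega> \<in> \<Omega>" and \<chi>: "\<chi> \<in> Irr G" "char_sum \<chi> (stabilizer G \<phi> \<omega>) = 0"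
    and a: "a \<in> carrier G" and b: "b \<in> carrier G"
  shows "(\<Sum>t\<in>carrier G. \<chi> t * of_bool (\<phi> t (\<phi> a \<omega>) = \<phi> b \<omega>)) = 0"
proof -
  obtain n \<rho> where rep: "matrix_semirep n \<rho>" and \<chi>\<rho>: "\<chi> = character G \<rho>"
    using \<chi>(1) by (auto simp: Irr_def irreducible_representation_def representation_iff_unital_semirep)
  let ?H = "stabilizer G \<phi> \<omega>"
  have HG: "?H \<subseteq> carrier G" by (auto simp: stabilizer_def)
  have "(\<Sum>h\<in>?H. trace (\<rho> h)) = char_sum \<chi> ?H"
    unfolding char_sum_def \<chi>\<rho> character_def using HG by (intro sum.cong) auto
  then have zero: "vanishing_sum n \<rho> ?H"
    using subgroup_sum_eq_0_if_character_sum_eq_0[OF rep stabilizer_subgroup[OF \<omega>]] \<chi>(2)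
      finite_subset[OF HG finite_group] by simp
  have "(\<Sum>t\<in>carrier G. \<chi> t * of_bool (\<phi> t (\<phi> a \<omega>) = \<phi> b \<omega>))
      = (\<Sum>t\<in>{t \<in> carrier G. \<phi> t (\<phi> a \<omega>) = \<phi> b \<omega>}. trace (\<rho> t))"
    using finite_group by (intro sum.mono_neutral_cong_right) (auto simp: \<chi>\<rho> character_def)
  also have "\<dots> = (\<Sum>h\<in>?H. trace (\<rho> (b \<otimes> h \<otimes> inv a)))"
  proof (rule sum.reindex_bij_witness[of _ "\<lambda>h. b \<otimes> h \<otimes> inv a" "\<lambda>t. inv b \<otimes> t \<otimes> a"])
    fix t assume t: "t \<in> {t \<in> carrier G. \<phi> t (\<phi> a \<omega>) = \<phi> b \<omega>}"
    then show "inv b \<otimes> t \<otimes> a \<in> ?H"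
      using a b \<omega> by (simp add: stabilizer_def composition_rule action_closed action_inv)
    show *: "b \<otimes> (inv b \<otimes> t \<otimes> a) \<otimes> inv a = t"
      using t a b by (simp add: m_assoc) (simp flip: m_assoc)
    show "trace (\<rho> (b \<otimes> (inv b \<otimes> t \<otimes> a) \<otimes> inv a)) = trace (\<rho> t)" using * by simp
  next
    fix h assume h: "h \<in> ?H"
    then have hG: "h \<in> carrier G" "\<phi> h \<omega> = \<omega>" by (auto simp: stabilizer_def)
    show "inv b \<otimes> (b \<otimes> h \<otimes> inv a) \<otimes> a = h"
      using hG a b by (simp add: m_assoc) (simp flip: m_assoc)
    show "b \<otimes> h \<otimes> inv a \<in> {t \<in> carrier G. \<phi> t (\<phi> a \<omega>) = \<phi> b \<omega>}"
      using hG a b \<omega> by (simp add: composition_rule action_closed action_inv)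
  qed
  also have "\<dots> = 0"
    using trace_sum_translate_eq_0[OF rep HG zero b inv_closed[OF a]] .
  finally show ?thesis .
qed

lemma inj_on_right_translate:
  assumes g: "g \<in> carrier G" and S: "S \<subseteq> carrier G"
  shows "inj_on (\<lambda>s. s \<otimes> g) S"
proof (rule inj_onI)
  fix s t assume "s \<in> S" "t \<in> S" "s \<otimes> g = t \<otimes> g"
  then show "s = t" using right_cancel[OF g, of s t] S by blast
qed

text \<open>Right translation leaves the quotients \<open>\<sigma> \<tau>\<^sup>-\<^sup>1\<close> unchanged.\<close>
lemma maximum_intersecting_translate:
  assumes S: "S \<in> maximum_intersecting_sets G \<Omega> \<phi>" and g: "g \<in> carrier G"
  shows "(\<lambda>s. s \<otimes> g) ` S \<in> maximum_intersecting_sets G \<Omega> \<phi>"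
proof -
  have SG: "S \<subseteq> carrier G" and int: "\<And>s t. s \<in> S \<Longrightarrow> t \<in> S \<Longrightarrow> intersect G \<Omega> \<phi> s t"
    using S by (auto simp: maximum_intersecting_sets_def intersecting_set_def)
  have eq: "(s \<otimes> g) \<otimes> inv (t \<otimes> g) = s \<otimes> inv t" if "s \<in> carrier G" "t \<in> carrier G" for s t
    using that g by (simp add: inv_mult_group m_assoc) (simp flip: m_assoc)
  have "intersecting_set G \<Omega> \<phi> ((\<lambda>s. s \<otimes> g) ` S)"
    unfolding intersecting_set_def
  proof (intro conjI ballI)
    show "(\<lambda>s. s \<otimes> g) ` S \<subseteq> carrier G" using SG g by auto
    fix \<sigma> \<tau> assume "\<sigma> \<in> (\<lambda>s. s \<otimes> g) ` S" "\<tau> \<in> (\<lambda>s. s \<otimes> g) ` S"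
    then obtain s t where st: "s \<in> S" "t \<in> S" "\<sigma> = s \<otimes> g" "\<tau> = t \<otimes> g" by blast
    then have "\<sigma> \<otimes> inv \<tau> = s \<otimes> inv t" using eq[of s t] SG by blast
    then show "intersect G \<Omega> \<phi> \<sigma> \<tau>" using int[OF st(1,2)] by (simp add: intersect_def)
  qed
  moreover have "card ((\<lambda>s. s \<otimes> g) ` S) = card S"
    by (rule card_image[OF inj_on_right_translate[OF g SG]])
  ultimately show ?thesis using S by (simp add: maximum_intersecting_sets_def)
qed

text \<open>The criterion for any transitive action, with a point stabilizer in the place of \<open>H\<close>; the action on
  cosets is the case of the base point \<open>H\<close>, whose stabilizer is \<open>H\<close>.\<close>
theorem EKR_module_property_iff_characters_vanish:
  assumes \<omega>: "\<omega> \<in> \<Omega>" and transitive: "\<And>\<alpha>. \<alpha> \<in> \<Omega> \<Longrightarrow> \<exists>a\<in>carrier G. \<phi> a \<omega> = \<alpha>"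
  shows "EKR_module_property G \<Omega> \<phi> \<longleftrightarrow>
    (\<forall>S\<in>maximum_intersecting_sets G \<Omega> \<phi>.
      \<forall>\<chi>\<in>{\<chi> \<in> Irr G. char_sum \<chi> (stabilizer G \<phi> \<omega>) = 0}. char_sum \<chi> S = 0)"
proof
  have max_sub: "S \<subseteq> carrier G" if "S \<in> maximum_intersecting_sets G \<Omega> \<phi>" for S
    using that by (auto simp: maximum_intersecting_sets_def intersecting_set_def)
  have canonical: "canonical_vec G \<phi> \<alpha> \<beta> t = of_bool (\<phi> t \<alpha> = \<beta>)" if "t \<in> carrier G" for \<alpha> \<beta> t
    using that by (simp add: canonical_vec_def char_vec_def indicator_def)
  {
    assume EKR: "EKR_module_property G \<Omega> \<phi>"
    show "\<forall>S\<in>maximum_intersecting_sets G \<Omega> \<phi>.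
      \<forall>\<chi>\<in>{\<chi> \<in> Irr G. char_sum \<chi> (stabilizer G \<phi> \<omega>) = 0}. char_sum \<chi> S = 0"
    proof (intro ballI)
      fix S \<chi> assume S: "S \<in> maximum_intersecting_sets G \<Omega> \<phi>"
        and "\<chi> \<in> {\<chi> \<in> Irr G. char_sum \<chi> (stabilizer G \<phi> \<omega>) = 0}"
      then have \<chi>: "\<chi> \<in> Irr G" "char_sum \<chi> (stabilizer G \<phi> \<omega>) = 0" by auto
      obtain c where c: "char_vec S = (\<lambda>g. \<Sum>\<alpha>\<in>\<Omega>. \<Sum>\<beta>\<in>\<Omega>. c \<alpha> \<beta> * canonical_vec G \<phi> \<alpha> \<beta> g)"
        using EKR S unfolding EKR_module_property_def by blast
      have "char_sum \<chi> S = (\<Sum>t\<in>carrier G. \<chi> t * char_vec S t)"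
        unfolding char_sum_def char_vec_def using max_sub[OF S] finite_group
        by (intro sum.mono_neutral_cong_left) auto
      also have "\<dots> = (\<Sum>t\<in>carrier G. \<Sum>\<alpha>\<in>\<Omega>. \<Sum>\<beta>\<in>\<Omega>. c \<alpha> \<beta> * (\<chi> t * of_bool (\<phi> t \<alpha> = \<beta>)))"
        by (intro sum.cong refl) (simp add: c canonical sum_distrib_left mult.left_commute)
      also have "\<dots> = (\<Sum>\<alpha>\<in>\<Omega>. \<Sum>\<beta>\<in>\<Omega>. \<Sum>t\<in>carrier G. c \<alpha> \<beta> * (\<chi> t * of_bool (\<phi> t \<alpha> = \<beta>)))"
        by (subst sum.swap, rule sum.cong[OF refl], subst sum.swap, rule refl)
      also have "\<dots> = 0"
      proof (rule sum.neutral, rule ballI, rule sum.neutral, rule ballI)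
        fix \<alpha> \<beta> assume "\<alpha> \<in> \<Omega>" "\<beta> \<in> \<Omega>"
        then obtain a b where "a \<in> carrier G" "\<phi> a \<omega> = \<alpha>" "b \<in> carrier G" "\<phi> b \<omega> = \<beta>"
          using transitive by meson
        then have "(\<Sum>t\<in>carrier G. \<chi> t * of_bool (\<phi> t \<alpha> = \<beta>)) = 0"
          using character_sum_canonical_eq_0[OF \<omega> \<chi>] by blast
        then show "(\<Sum>t\<in>carrier G. c \<alpha> \<beta> * (\<chi> t * of_bool (\<phi> t \<alpha> = \<beta>))) = 0"
          unfolding sum_distrib_left[symmetric] by (simp only: mult_zero_right)
      qed
      finally show "char_sum \<chi> S = 0" .
    qed
  }
  assume van: "\<forall>S\<in>maximum_intersecting_sets G \<Omega> \<phi>.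
      \<forall>\<chi>\<in>{\<chi> \<in> Irr G. char_sum \<chi> (stabilizer G \<phi> \<omega>) = 0}. char_sum \<chi> S = 0"
  show "EKR_module_property G \<Omega> \<phi>"
    unfolding EKR_module_property_def
  proof
    fix S assume S: "S \<in> maximum_intersecting_sets G \<Omega> \<phi>"
    note SG = max_sub[OF S]
    have "(\<Sum>t\<in>carrier G. char_vec S t * \<chi> (t \<otimes> g)) = 0"
      if "\<chi> \<in> Irr G" "char_sum \<chi> (stabilizer G \<phi> \<omega>) = 0" and g: "g \<in> carrier G" for \<chi> g
    proof -
      have "(\<Sum>t\<in>carrier G. char_vec S t * \<chi> (t \<otimes> g)) = (\<Sum>t\<in>S. \<chi> (t \<otimes> g))"
        unfolding char_vec_def using SG finite_group
        by (intro sum.mono_neutral_cong_right) auto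
      also have "\<dots> = char_sum \<chi> ((\<lambda>s. s \<otimes> g) ` S)"
        unfolding char_sum_def by (simp add: sum.reindex[OF inj_on_right_translate[OF g SG]])
      also have "\<dots> = 0" using van maximum_intersecting_translate[OF S g] that by blast
      finally show ?thesis .
    qed
    then obtain c where c: "\<And>g. g \<in> carrier G \<Longrightarrow>
        char_vec S g = (\<Sum>\<alpha>\<in>\<Omega>. \<Sum>\<beta>\<in>\<Omega>. c \<alpha> \<beta> * of_bool (\<phi> g \<alpha> = \<beta>))"
      using canonical_span_if_characters_vanish[OF \<omega>] by blast
    have "char_vec S g = (\<Sum>\<alpha>\<in>\<Omega>. \<Sum>\<beta>\<in>\<Omega>. c \<alpha> \<beta> * canonical_vec G \<phi> \<alpha> \<beta> g)" for g
    proof (cases "g \<in> carrier G")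
      case True
      then show ?thesis by (simp only: c canonical)
    next
      case False
      then have "g \<notin> S" using SG by blast
      with False show ?thesis by (simp add: canonical_vec_def char_vec_def)
    qed
    then show "\<exists>c. char_vec S = (\<lambda>g. \<Sum>\<alpha>\<in>\<Omega>. \<Sum>\<beta>\<in>\<Omega>. c \<alpha> \<beta> * canonical_vec G \<phi> \<alpha> \<beta> g)"
      by blast
  qed
qed

end

theorem theorem1p5:
  fixes G :: "('a, 'b) monoid_scheme" and H :: "'a set"
  assumes "group G" and "finite (carrier G)" and "subgroup H G"
  defines "\<Omega> \<equiv> lcosets\<^bsub>G\<^esub> H"
    and "\<phi> \<equiv> left_coset_action G H"
  defines "C \<equiv> {\<chi> \<in> Irr G. char_sum \<chi> H = 0}"
    and "\<SS> \<equiv> maximum_intersecting_sets G \<Omega> \<phi>"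
  shows "EKR_module_property G \<Omega> \<phi> \<longleftrightarrow> (\<forall>S\<in>\<SS>. \<forall>\<chi>\<in>C. char_sum \<chi> S = 0)"
proof -
  interpret group G by fact
  interpret H: subgroup H G by fact
  interpret transitive_action G \<Omega> \<phi>
    unfolding \<Omega>_def \<phi>_def by (rule left_coset_action_transitive[OF assms(1,3)])
  have "finite \<Omega>"
    using assms(2) by (simp add: \<Omega>_def LCOSETS_def)
  then interpret finite_group_action G \<Omega> \<phi>
    by unfold_locales (use assms(2) in auto)
  have H_coset: "H \<in> \<Omega>"
    unfolding \<Omega>_def LCOSETS_def using lcos_mult_one[OF H.subset] one_closed by blast
  have "stabilizer G \<phi> H = {g \<in> carrier G. g <#\<^bsub>G\<^esub> H = H}"
    using H_coset by (auto simp: stabilizer_def \<phi>_def left_coset_action_def \<Omega>_def)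
  also have "\<dots> = H"
  proof
    show "{g \<in> carrier G. g <#\<^bsub>G\<^esub> H = H} \<subseteq> H"
    proof
      fix g assume "g \<in> {g \<in> carrier G. g <#\<^bsub>G\<^esub> H = H}"
      then have "g \<otimes>\<^bsub>G\<^esub> \<one>\<^bsub>G\<^esub> \<in> H" "g \<in> carrier G" using H.one_closed by (auto simp: l_coset_def)
      then show "g \<in> H" by simp
    qed
    show "H \<subseteq> {g \<in> carrier G. g <#\<^bsub>G\<^esub> H = H}"
      using lcos_mult_one[OF H.subset] assms(3) H.mem_carrier
      by (auto simp: coset_join3)
  qed
  finally have stab: "stabilizer G \<phi> H = H" .
  show ?thesis
    using EKR_module_property_iff_characters_vanish[OF H_coset unique_orbit[OF H_coset]]
    unfolding stab C_def \<SS>_def .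
qed

end
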